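(* Let $C,\hat C>0$ be constants. Then there exists a constant $c>0$ (depending only on $C,\hat C$) such that the following holds. Consider the model $Y=X\beta^*+W$ with parameters $n,p,k,\sigma^2$, where $k<n$, $$\hat C\sigma^2\le k\le \min\{1,\sigma^2\}\exp\left(C\sqrt{\log p}\right),\qquad n^*\le n\le c\,k\log p,\qquad n^*:=\frac{2k\log p}{\log\left(\frac{2k}{\sigma^2}+1\right)},$$ and $\beta^*\in\{0,1\}^p$ is a binary vector with exactly $k$ non-zero coordinates. Let $\lambda$ be any number satisfying $$\lambda\ge\frac{\sigma}{\sqrt k}\exp\left(-\frac{k\log p}{5n}\right),$$ and let $\hat\beta_{\mathrm{LASSO},\lambda}$ and $\hat\beta_{\mathrm{LASSO(box)},\lambda}$ be optimal solutions of $$\mathrm{LASSO}_\lambda:\ \min_{\beta\in\mathbb R^p} n^{-1}\|Y-X\beta\|_2^2+\lambda\|\beta\|_1,\qquad \mathrm{LASSO(box)}_\lambda:\ \min_{\beta\in[0,1]^p} n^{-1}\|Y-X\beta\|_2^2+\lambda\|\beta\|_1,$$ respectively. Then, w.h.p. as $k\to+\infty$, $$\min\left(\|\hat\beta_{\mathrm{LASSO},\lambda}-\beta^*\|_2,\ \|\hat\beta_{\mathrm{LASSO(box)},\lambda}-\beta^*\|_2\right)\ \ge\ \exp\left(\frac{k\log p}{5n}\right)\sigma .$$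
   Context: Model: $n,p,k$ are positive integers and $\sigma>0$; $X\in\mathbb R^{n\times p}$ has i.i.d. $N(0,1)$ entries, $W\in\mathbb R^n$ has i.i.d. $N(0,\sigma^2)$ entries, $X$ and $W$ are independent, $\beta^*\in\mathbb R^p$ is deterministic and $Y=X\beta^*+W$. $\log$ is the natural logarithm. "W.h.p. as $k\to+\infty$" means: for every $\varepsilon>0$ there is $k_0$ such that for all choices of the parameters ($n,p,k,\sigma^2,\beta^*,\lambda$) satisfying the hypotheses with $k\ge k_0$, the stated event has probability at least $1-\varepsilon$. *)

theory Defs
  imports "HOL-Probability.Probability"
begin

text \<open>
  The dimensions \<open>n\<close> and \<open>p\<close> are quantified inside the theorem, so vectors in \<open>\<real>\<^sup>p\<close> are functions
  \<open>nat \<Rightarrow> real\<close> of which only the coordinates below \<open>p\<close> are ever used, and \<open>n \<times> p\<close> matrices are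
  functions \<open>nat \<times> nat \<Rightarrow> real\<close> on \<open>{..<n} \<times> {..<p}\<close>.
\<close>

definition mat_vec :: "nat \<Rightarrow> (nat \<times> nat \<Rightarrow> real) \<Rightarrow> (nat \<Rightarrow> real) \<Rightarrow> nat \<Rightarrow> real" where
  "mat_vec p X b = (\<lambda>i. \<Sum>j<p. X (i, j) * b j)"

definition norm2 :: "nat \<Rightarrow> (nat \<Rightarrow> real) \<Rightarrow> real" where
  "norm2 m v = L2_set v {..<m}"

definition norm1 :: "nat \<Rightarrow> (nat \<Rightarrow> real) \<Rightarrow> real" where
  "norm1 m v = (\<Sum>j<m. \<bar>v j\<bar>)"

definition lasso_objective ::
  "nat \<Rightarrow> nat \<Rightarrow> (nat \<times> nat \<Rightarrow> real) \<Rightarrow> (nat \<Rightarrow> real) \<Rightarrow> real \<Rightarrow> (nat \<Rightarrow> real) \<Rightarrow> real" where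
  "lasso_objective n p X Y lam b =
     (norm2 n (\<lambda>i. Y i - mat_vec p X b i))\<^sup>2 / real n + lam * norm1 p b"

definition is_LASSO ::
  "nat \<Rightarrow> nat \<Rightarrow> (nat \<times> nat \<Rightarrow> real) \<Rightarrow> (nat \<Rightarrow> real) \<Rightarrow> real \<Rightarrow> (nat \<Rightarrow> real) \<Rightarrow> bool" where
  "is_LASSO n p X Y lam b \<longleftrightarrow> is_arg_min (lasso_objective n p X Y lam) (\<lambda>_. True) b"

definition is_LASSO_box ::
  "nat \<Rightarrow> nat \<Rightarrow> (nat \<times> nat \<Rightarrow> real) \<Rightarrow> (nat \<Rightarrow> real) \<Rightarrow> real \<Rightarrow> (nat \<Rightarrow> real) \<Rightarrow> bool" where
  "is_LASSO_box n p X Y lam b \<longleftrightarrow>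
     is_arg_min (lasso_objective n p X Y lam) (\<lambda>b. \<forall>j<p. b j \<in> {0..1}) b"

definition binary_sparse :: "nat \<Rightarrow> nat \<Rightarrow> (nat \<Rightarrow> real) \<Rightarrow> bool" where
  "binary_sparse p k b \<longleftrightarrow> (\<forall>j<p. b j \<in> {0, 1}) \<and> card {j. j < p \<and> b j \<noteq> 0} = k"

definition n_star :: "nat \<Rightarrow> nat \<Rightarrow> real \<Rightarrow> real" where
  "n_star p k \<sigma> = 2 * real k * ln (real p) / ln (2 * real k / \<sigma>\<^sup>2 + 1)"

text \<open>The centred normal law; as in \<^const>\<open>normal_density\<close>, \<open>s\<close> is the standard deviation.\<close>

definition gaussian :: "real \<Rightarrow> real measure" where
  "gaussian s = density lborel (\<lambda>x. ennreal (normal_density 0 s x))"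

text \<open>
  The joint law of the design and the noise: the coordinates of a sample \<open>(X, W)\<close> are independent,
  the entries of \<open>X\<close> are \<open>N(0, 1)\<close> and those of \<open>W\<close> are \<open>N(0, \<sigma>\<^sup>2)\<close>.  Working with the law itself,
  rather than with random variables on a space of arbitrary type, keeps the constants of the
  theorem from depending on that type; \<open>gaussian_model_law\<close> and \<open>with_prob_at_least_distr\<close> below
  carry statements over to any probability space.
\<close>

definition model_law ::
  "nat \<Rightarrow> nat \<Rightarrow> real \<Rightarrow> ((nat \<times> nat \<Rightarrow> real) \<times> (nat \<Rightarrow> real)) measure" where
  "model_law n p \<sigma> =
     (\<Pi>\<^sub>M ij\<in>{..<n} \<times> {..<p}. gaussian 1) \<Otimes>\<^sub>M (\<Pi>\<^sub>M i\<in>{..<n}. gaussian \<sigma>)"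

text \<open>
  ``\<open>P\<close> has probability at least \<open>q\<close>'', read as inner probability.  For measurable \<open>P\<close> this is
  the usual meaning, as \<open>with_prob_at_least_iff\<close> shows.  It lets \<open>P\<close> quantify over all optimal
  solutions, without fixing a measurable choice of one.
\<close>

definition with_prob_at_least :: "'a measure \<Rightarrow> real \<Rightarrow> ('a \<Rightarrow> bool) \<Rightarrow> bool" where
  "with_prob_at_least M q P \<longleftrightarrow> (\<exists>A\<in>sets M. q \<le> measure M A \<and> (\<forall>\<omega>\<in>A. P \<omega>))"

lemma with_prob_at_least_iff:
  assumes "prob_space M" and "{\<omega> \<in> space M. P \<omega>} \<in> sets M"
  shows "with_prob_at_least M q P \<longleftrightarrow> q \<le> measure M {\<omega> \<in> space M. P \<omega>}"
proof -
  interpret prob_space M by fact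
  show ?thesis
  proof
    assume "with_prob_at_least M q P"
    then obtain A where A: "A \<in> sets M" "q \<le> measure M A" "\<forall>\<omega>\<in>A. P \<omega>"
      unfolding with_prob_at_least_def by blast
    then have "A \<subseteq> {\<omega> \<in> space M. P \<omega>}"
      using sets.sets_into_space by blast
    then have "measure M A \<le> measure M {\<omega> \<in> space M. P \<omega>}"
      using assms(2) by (rule finite_measure_mono)
    with A show "q \<le> measure M {\<omega> \<in> space M. P \<omega>}" by simp
  next
    assume "q \<le> measure M {\<omega> \<in> space M. P \<omega>}"
    with assms(2) show "with_prob_at_least M q P"
      unfolding with_prob_at_least_def by blast
  qed
qed

lemma with_prob_at_least_distr:
  assumes "f \<in> measurable M N" and "with_prob_at_least (distr M N f) q P"
  shows "with_prob_at_least M q (\<lambda>\<omega>. P (f \<omega>))"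
proof -
  obtain A where A: "A \<in> sets N" "q \<le> measure (distr M N f) A" "\<forall>x\<in>A. P x"
    using assms(2) unfolding with_prob_at_least_def by auto
  then have "q \<le> measure M (f -` A \<inter> space M)"
    using assms(1) by (simp add: measure_distr)
  moreover have "f -` A \<inter> space M \<in> sets M"
    using assms(1) A(1) by (rule measurable_sets)
  ultimately show ?thesis
    unfolding with_prob_at_least_def using A(3) by blast
qed

lemma prob_space_gaussian: "0 < s \<Longrightarrow> prob_space (gaussian s)"
  unfolding gaussian_def by (rule prob_space_normal_density)

lemma prob_space_model_law:
  assumes "0 < \<sigma>"
  shows "prob_space (model_law n p \<sigma>)"
proof -
  interpret A: prob_space "\<Pi>\<^sub>M ij\<in>{..<n} \<times> {..<p}. gaussian 1"
    by (rule prob_space_PiM) (simp add: prob_space_gaussian assms)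
  interpret B: prob_space "\<Pi>\<^sub>M i\<in>{..<n}. gaussian \<sigma>"
    by (rule prob_space_PiM) (simp add: prob_space_gaussian assms)
  interpret pair_prob_space "\<Pi>\<^sub>M ij\<in>{..<n} \<times> {..<p}. gaussian 1" "\<Pi>\<^sub>M i\<in>{..<n}. gaussian \<sigma>" ..
  show ?thesis unfolding model_law_def by unfold_locales
qed

lemma gaussian_model_law:
  fixes X :: "nat \<times> nat \<Rightarrow> 'a \<Rightarrow> real" and W :: "nat \<Rightarrow> 'a \<Rightarrow> real" and n p :: nat
  defines "XX \<equiv> \<lambda>\<omega>. \<lambda>ij\<in>{..<n} \<times> {..<p}. X ij \<omega>" and "WW \<equiv> \<lambda>\<omega>. \<lambda>i\<in>{..<n}. W i \<omega>"
  defines "S \<equiv> \<Pi>\<^sub>M ij\<in>{..<n} \<times> {..<p}. borel" and "T \<equiv> \<Pi>\<^sub>M i\<in>{..<n}. borel"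
  assumes "prob_space M" and "0 < n" "0 < p"
    and X: "\<And>i j. i < n \<Longrightarrow> j < p \<Longrightarrow> distributed M lborel (X (i, j)) (normal_density 0 1)"
    and W: "\<And>i. i < n \<Longrightarrow> distributed M lborel (W i) (normal_density 0 \<sigma>)"
    and indX: "prob_space.indep_vars M (\<lambda>_. borel) X ({..<n} \<times> {..<p})"
    and indW: "prob_space.indep_vars M (\<lambda>_. borel) W {..<n}"
    and ind: "\<And>A B. A \<in> sets S \<Longrightarrow> B \<in> sets T \<Longrightarrow>
      measure M {\<omega> \<in> space M. XX \<omega> \<in> A \<and> WW \<omega> \<in> B} =
      measure M {\<omega> \<in> space M. XX \<omega> \<in> A} * measure M {\<omega> \<in> space M. WW \<omega> \<in> B}"
  shows "distr M (S \<Otimes>\<^sub>M T) (\<lambda>\<omega>. (XX \<omega>, WW \<omega>)) = model_law n p \<sigma>"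
proof -
  interpret prob_space M by fact
  have law: "distr M borel Z = gaussian s"
    if "distributed M lborel Z (normal_density 0 s)" for Z s
  proof -
    have "distr M borel Z = distr M lborel Z"
      by (rule distr_cong) auto
    with that show ?thesis by (simp add: distributed_def gaussian_def)
  qed
  have rvX: "random_variable borel (X ij)" if "ij \<in> {..<n} \<times> {..<p}" for ij
    using indX that unfolding indep_vars_def by blast
  have rvW: "random_variable borel (W i)" if "i \<in> {..<n}" for i
    using indW that unfolding indep_vars_def by blast
  have "distr M S XX = (\<Pi>\<^sub>M ij\<in>{..<n} \<times> {..<p}. distr M borel (X ij))"
    unfolding S_def XX_def using indX \<open>0 < n\<close> \<open>0 < p\<close> rvX
    by (subst indep_vars_iff_distr_eq_PiM'[symmetric]) auto
  also have "\<dots> = (\<Pi>\<^sub>M ij\<in>{..<n} \<times> {..<p}. gaussian 1)"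
    by (rule PiM_cong) (auto intro!: law X)
  finally have 1: "distr M S XX = (\<Pi>\<^sub>M ij\<in>{..<n} \<times> {..<p}. gaussian 1)" .
  have "distr M T WW = (\<Pi>\<^sub>M i\<in>{..<n}. distr M borel (W i))"
    unfolding T_def WW_def using indW \<open>0 < n\<close> rvW
    by (subst indep_vars_iff_distr_eq_PiM'[symmetric]) auto
  also have "\<dots> = (\<Pi>\<^sub>M i\<in>{..<n}. gaussian \<sigma>)"
    by (rule PiM_cong) (auto intro!: law W)
  finally have 2: "distr M T WW = (\<Pi>\<^sub>M i\<in>{..<n}. gaussian \<sigma>)" .
  have mX [measurable]: "XX \<in> measurable M S"
    unfolding XX_def S_def by (rule measurable_restrict) (rule rvX)
  have mW [measurable]: "WW \<in> measurable M T"
    unfolding WW_def T_def by (rule measurable_restrict) (rule rvW)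
  interpret dX: prob_space "distr M S XX" by (rule prob_space_distr) (rule mX)
  interpret dW: prob_space "distr M T WW" by (rule prob_space_distr) (rule mW)
  have "distr M S XX \<Otimes>\<^sub>M distr M T WW = distr M (S \<Otimes>\<^sub>M T) (\<lambda>\<omega>. (XX \<omega>, WW \<omega>))"
  proof (rule pair_measure_eqI)
    fix A B assume "A \<in> sets (distr M S XX)" "B \<in> sets (distr M T WW)"
    then have AB [measurable]: "A \<in> sets S" "B \<in> sets T" by auto
    have "emeasure (distr M (S \<Otimes>\<^sub>M T) (\<lambda>\<omega>. (XX \<omega>, WW \<omega>))) (A \<times> B) =
        emeasure M {\<omega> \<in> space M. XX \<omega> \<in> A \<and> WW \<omega> \<in> B}"
      by (subst emeasure_distr) (auto intro!: arg_cong[where f = "emeasure M"])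
    also have "\<dots> = ennreal (measure M {\<omega> \<in> space M. XX \<omega> \<in> A} *
        measure M {\<omega> \<in> space M. WW \<omega> \<in> B})"
      by (simp add: emeasure_eq_measure ind[OF AB])
    also have "\<dots> = emeasure M {\<omega> \<in> space M. XX \<omega> \<in> A} * emeasure M {\<omega> \<in> space M. WW \<omega> \<in> B}"
      by (simp add: emeasure_eq_measure ennreal_mult)
    also have "\<dots> = emeasure (distr M S XX) A * emeasure (distr M T WW) B"
      by (simp add: emeasure_distr vimage_def Int_def conj_commute)
    finally show "emeasure (distr M S XX) A * emeasure (distr M T WW) B =
        emeasure (distr M (S \<Otimes>\<^sub>M T) (\<lambda>\<omega>. (XX \<omega>, WW \<omega>))) (A \<times> B)" by simp
  qed (auto intro: dX.sigma_finite_measure_axioms dW.sigma_finite_measure_axioms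
        cong: sets_pair_measure_cong)
  then show ?thesis unfolding 1 2 model_law_def by simp
qed

end

theory Submission
  imports Defs "HOL-Real_Asymp.Real_Asymp"
begin

text \<open>
  Write \<open>L = k ln p / n\<close>.  An optimal solution far smaller than \<open>\<beta>\<close> in the \<open>\<ell>\<^sub>1\<close> norm is far from
  \<open>\<beta>\<close>: if \<open>norm1 p b \<le> k / 2\<close>, then Cauchy--Schwarz on the \<open>k\<close> coordinates of the support of \<open>\<beta>\<close>
  gives \<open>norm2 p (b - \<beta>) \<ge> sqrt k / 2\<close> (\<open>distance_from_binary_ge\<close>).  This is more than
  \<open>exp (L / 5) * \<sigma>\<close>: the bound \<open>n_star \<le> n\<close> says \<open>exp (2 * L) \<le> 2 * k / \<sigma>\<^sup>2 + 1\<close>, so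
  \<open>exp (L / 5)\<close> is of order at most \<open>(k / \<sigma>\<^sup>2)\<close> to the power \<open>1/10\<close>, while \<open>L \<ge> 1 / c\<close> forces
  \<open>k / \<sigma>\<^sup>2\<close> to be huge (\<open>signal_to_noise_dominates\<close>).

  Both optimal solutions are that small in the \<open>\<ell>\<^sub>1\<close> norm because the columns of \<open>X\<close> are
  so plentiful that \<open>Y\<close> can be explained by about \<open>k / 2\<close> of them.  Uniformly in the direction
  \<open>u \<in> \<real>\<^sup>n\<close>, at least \<open>s = k div 2\<close> columns have inner product at least \<open>a * norm2 n u\<close> with \<open>u\<close>, where
  \<open>a = sqrt (ln p) / 8\<close>.  Since \<open>norm2 n Y\<close> is of order \<open>sqrt (k * n)\<close> and \<open>n \<le> c * k * ln p\<close>, a small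
  \<open>c\<close> yields \<open>norm2 n Y \<le> s * a\<close>.  Take for \<open>u\<close> the residual \<open>r\<close> of an optimal solution \<open>b\<close>, and let
  \<open>v\<close> be the indicator of \<open>s\<close> such columns.  Then \<open>r\<close> has inner product at least
  \<open>norm2 n Y * norm2 n r\<close> with \<open>X v\<close>, so moving from \<open>b\<close> towards \<open>v\<close> does not worsen the fit to first
  order.  By optimality it cannot decrease the penalty, that is, \<open>norm1 p b \<le> norm1 p v = s\<close>
  (\<open>lasso_norm1_le\<close>).  As \<open>v\<close> lies in the box, the same argument serves both problems.

  The uniform statement is a union bound.  Cut the first columns into \<open>s\<close> blocks of
  \<open>q = p div s\<close> columns.  For a fixed \<open>u\<close> the inner products with the columns are independent
  normal variables, so a block contains no good column with probability at most
  \<open>(1 - \<tau>) ^ q\<close>, where \<open>\<tau>\<close> is of order \<open>p\<close> to the power \<open>-1/4\<close>.  It is enough to treat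
  integer vectors \<open>u\<close> with entries between \<open>-p\<^sup>2\<close> and \<open>p\<^sup>2\<close>, of which there are
  \<open>exp (O (n * ln p))\<close>; and \<open>k \<le> exp (C * sqrt (ln p))\<close> makes \<open>k\<close> and \<open>n\<close> smaller than any power of
  \<open>p\<close>, so that \<open>\<tau> * q\<close> dominates \<open>n * ln p\<close>.
\<close>

section \<open>Linear combinations of independent normal variables\<close>

lemma sets_gaussian [simp, measurable_cong]: "sets (gaussian s) = sets borel"
  by (simp add: gaussian_def)

lemma space_gaussian [simp]: "space (gaussian s) = UNIV"
  by (simp add: gaussian_def)

lemma indep_vars_coordinates:
  assumes "0 < s"
  shows "prob_space.indep_vars (PiM I (\<lambda>_. gaussian s)) (\<lambda>_. borel) (\<lambda>i \<omega>. \<omega> i) I"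
proof -
  interpret prob_space "PiM I (\<lambda>_. gaussian s)"
    by (intro prob_space_PiM prob_space_gaussian assms)
  show ?thesis
  proof (cases "I = {}")
    case False
    have eq: "distr (PiM I (\<lambda>_. gaussian s)) borel (\<lambda>\<omega>. \<omega> i) = gaussian s" if "i \<in> I" for i
    proof -
      have "distr (PiM I (\<lambda>_. gaussian s)) borel (\<lambda>\<omega>. \<omega> i) =
          distr (PiM I (\<lambda>_. gaussian s)) (gaussian s) (\<lambda>\<omega>. \<omega> i)"
        by (rule distr_cong) auto
      also have "\<dots> = gaussian s"
        using that assms by (intro distr_PiM_component[where M="\<lambda>_. gaussian s"] prob_space_gaussian)
      finally show ?thesis .
    qed
    have "distr (PiM I (\<lambda>_. gaussian s)) (PiM I (\<lambda>_. borel)) (\<lambda>\<omega>. \<lambda>i\<in>I. \<omega> i) =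
        distr (PiM I (\<lambda>_. gaussian s)) (PiM I (\<lambda>_. gaussian s)) (\<lambda>\<omega>. \<omega>)"
      by (rule distr_cong) (auto simp: space_PiM PiE_def extensional_restrict intro!: sets_PiM_cong)
    also have "\<dots> = PiM I (\<lambda>i. distr (PiM I (\<lambda>_. gaussian s)) borel (\<lambda>\<omega>. \<omega> i))"
      by (simp add: distr_id2) (intro PiM_cong, auto simp: eq)
    finally show ?thesis
      using False by (subst indep_vars_iff_distr_eq_PiM') auto
  next
    case True
    show ?thesis
      unfolding indep_vars_def indep_sets_def using True by auto
  qed
qed

lemma distributed_coordinate:
  assumes "0 < s" "i \<in> I"
  shows "distributed (PiM I (\<lambda>_. gaussian s)) lborel (\<lambda>\<omega>. \<omega> i) (normal_density 0 s)"
proof -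
  have "distr (PiM I (\<lambda>_. gaussian s)) lborel (\<lambda>\<omega>. \<omega> i) =
      distr (PiM I (\<lambda>_. gaussian s)) (gaussian s) (\<lambda>\<omega>. \<omega> i)"
    by (rule distr_cong) auto
  also have "\<dots> = gaussian s"
    using assms by (intro distr_PiM_component[where M="\<lambda>_. gaussian s"] prob_space_gaussian)
  finally show ?thesis
    using assms by (auto simp: distributed_def gaussian_def)
qed

text \<open>
  The library rule for sums of independent normal variables asks for positive standard
  deviations, so the terms with coefficient \<open>0\<close> are dropped before it is applied.
\<close>
lemma distributed_unit_combination:
  fixes a :: "'i \<Rightarrow> real"
  assumes "0 < s" "finite K" "K \<subseteq> I" and unit: "(\<Sum>i\<in>K. (a i)\<^sup>2) = 1"
  shows "distributed (PiM I (\<lambda>_. gaussian s)) lborel (\<lambda>\<omega>. \<Sum>i\<in>K. a i * \<omega> i) (normal_density 0 s)"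
proof -
  let ?P = "PiM I (\<lambda>_. gaussian s)"
  interpret prob_space ?P
    by (intro prob_space_PiM prob_space_gaussian assms)
  define J where "J = {i\<in>K. a i \<noteq> 0}"
  have J: "finite J" "J \<subseteq> I" "\<And>i. i \<in> J \<Longrightarrow> a i \<noteq> 0"
    using assms by (auto simp: J_def)
  have sumJ: "(\<Sum>i\<in>K. g i) = (\<Sum>i\<in>J. g i)" if "\<And>i. a i = 0 \<Longrightarrow> g i = 0" for g :: "'i \<Rightarrow> real"
    unfolding J_def using assms(2) that by (intro sum.mono_neutral_right) auto
  have unitJ: "(\<Sum>i\<in>J. (a i)\<^sup>2) = 1"
    using unit by (subst (asm) sumJ) auto
  then have "J \<noteq> {}" by auto
  have ind: "indep_vars (\<lambda>_. borel) (\<lambda>i \<omega>. a i * \<omega> i) J"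
    by (rule indep_vars_compose2[where Y="\<lambda>i x. a i * x"])
       (auto intro: indep_vars_subset[OF indep_vars_coordinates[OF assms(1)]] J(2)[THEN subsetD])
  have dis: "distributed ?P lborel (\<lambda>\<omega>. a i * \<omega> i) (normal_density 0 (\<bar>a i\<bar> * s))" if "i \<in> J" for i
    using normal_density_affine[OF distributed_coordinate[of s i I], where \<beta>=0 and \<alpha>="a i"] that J assms(1)
    by auto
  have "distributed ?P lborel (\<lambda>\<omega>. \<Sum>i\<in>J. a i * \<omega> i)
      (normal_density (\<Sum>i\<in>J. 0) (sqrt (\<Sum>i\<in>J. (\<bar>a i\<bar> * s)\<^sup>2)))"
    using J assms(1) by (intro sum_indep_normal \<open>J \<noteq> {}\<close> ind dis) auto
  also have "(\<Sum>i\<in>J. (\<bar>a i\<bar> * s)\<^sup>2) = s\<^sup>2"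
    using unitJ by (simp add: power_mult_distrib flip: sum_distrib_right)
  also have "sqrt (s\<^sup>2) = s" using assms(1) by simp
  finally show ?thesis by (subst sumJ) auto
qed

lemma indep_vars_combinations:
  fixes a :: "'l \<Rightarrow> 'i \<Rightarrow> real"
  assumes "0 < s" "\<And>l. l \<in> L \<Longrightarrow> K l \<subseteq> I" "disjoint_family_on K L"
  shows "prob_space.indep_vars (PiM I (\<lambda>_. gaussian s)) (\<lambda>_. borel)
    (\<lambda>l \<omega>. \<Sum>i\<in>K l. a l i * \<omega> i) L"
proof -
  let ?P = "PiM I (\<lambda>_. gaussian s)"
  interpret prob_space ?P
    by (intro prob_space_PiM prob_space_gaussian assms)
  have "indep_vars (\<lambda>_. borel)
      (\<lambda>l \<omega>. \<Sum>i\<in>K l. a l i * (restrict (\<lambda>i. \<omega> i) (K l)) i) L"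
    by (rule indep_vars_compose2[where Y="\<lambda>l x. \<Sum>i\<in>K l. a l i * x i",
          OF indep_vars_restrict[OF indep_vars_coordinates[OF assms(1)] assms(2,3)]]) auto
  then show ?thesis
    by (rule indep_vars_cong[THEN iffD1, rotated -1]) (auto intro!: sum.cong)
qed

section \<open>Tail bounds\<close>

lemma normal_density_times_exp_square:
  assumes "0 < s"
  shows "normal_density 0 s x * exp (x\<^sup>2 / (4 * s\<^sup>2)) = sqrt 2 * normal_density 0 (sqrt 2 * s) x"
  using assms
  by (simp add: normal_density_def real_sqrt_mult power_mult_distrib field_simps flip: exp_add)

text \<open>
  Chernoff's bound: the \<open>l\<close>-th combination \<open>G\<close> is normal with standard deviation \<open>s\<close>, so
  \<open>exp (G\<^sup>2 / (4 * s\<^sup>2))\<close> has expectation \<open>sqrt 2\<close>, and by independence the exponential of the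
  whole sum has expectation \<open>sqrt 2 ^ card L\<close>, to be compared with \<open>exp (card L)\<close>.  The
  quotient \<open>sqrt 2 * exp (-1)\<close> is below \<open>1\<close>, so one threshold serves for every failure probability;
  Markov's inequality for the sum of squares itself would make the threshold, and with it the
  constant \<open>c\<close> of the theorem, depend on \<open>\<epsilon>\<close>.
\<close>
lemma sum_squares_tail:
  fixes a :: "'l \<Rightarrow> 'i \<Rightarrow> real"
  assumes "0 < s" "finite L" "\<And>l. l \<in> L \<Longrightarrow> K l \<subseteq> I" "disjoint_family_on K L"
    and fin: "\<And>l. l \<in> L \<Longrightarrow> finite (K l)"
    and unit: "\<And>l. l \<in> L \<Longrightarrow> (\<Sum>i\<in>K l. (a l i)\<^sup>2) = 1"
  defines "P \<equiv> PiM I (\<lambda>_. gaussian s)"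
  shows "{\<omega> \<in> space P. 4 * real (card L) * s\<^sup>2 < (\<Sum>l\<in>L. (\<Sum>i\<in>K l. a l i * \<omega> i)\<^sup>2)} \<in> sets P"
    and "measure P {\<omega> \<in> space P. 4 * real (card L) * s\<^sup>2 < (\<Sum>l\<in>L. (\<Sum>i\<in>K l. a l i * \<omega> i)\<^sup>2)}
    \<le> (sqrt 2 * exp (-1)) ^ card L"
proof -
  interpret prob_space P
    unfolding P_def by (intro prob_space_PiM prob_space_gaussian assms)
  define G where "G = (\<lambda>l \<omega>. \<Sum>i\<in>K l. a l i * \<omega> i)"
  have dis: "distributed P lborel (G l) (normal_density 0 s)" if "l \<in> L" for l
    unfolding G_def P_def using that by (intro distributed_unit_combination assms)
  have mG [measurable]: "G l \<in> borel_measurable P" if "l \<in> L" for l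
    using distributed_measurable[OF dis[OF that]] by simp
  have "{\<omega> \<in> space P. 4 * real (card L) * s\<^sup>2 < (\<Sum>l\<in>L. (G l \<omega>)\<^sup>2)} \<in> sets P"
    by measurable
  then show "{\<omega> \<in> space P. 4 * real (card L) * s\<^sup>2 < (\<Sum>l\<in>L. (\<Sum>i\<in>K l. a l i * \<omega> i)\<^sup>2)} \<in> sets P"
    unfolding G_def .
  have "indep_vars (\<lambda>_. borel) G L"
    unfolding G_def P_def by (rule indep_vars_combinations[OF assms(1,3,4)])
  then have ind: "indep_vars (\<lambda>_. borel) (\<lambda>l \<omega>. ennreal (exp ((G l \<omega>)\<^sup>2 / (4 * s\<^sup>2)))) L"
    by (rule indep_vars_compose2[where Y="\<lambda>l x. ennreal (exp (x\<^sup>2 / (4 * s\<^sup>2)))"]) auto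
  have mgf: "(\<integral>\<^sup>+\<omega>. ennreal (exp ((G l \<omega>)\<^sup>2 / (4 * s\<^sup>2))) \<partial>P) = ennreal (sqrt 2)" if "l \<in> L" for l
  proof -
    have "(\<integral>\<^sup>+\<omega>. ennreal (exp ((G l \<omega>)\<^sup>2 / (4 * s\<^sup>2))) \<partial>P) =
        (\<integral>\<^sup>+x. ennreal (normal_density 0 s x) * ennreal (exp (x\<^sup>2 / (4 * s\<^sup>2))) \<partial>lborel)"
      by (rule distributed_nn_integral[OF dis[OF that], symmetric]) auto
    also have "\<dots> = (\<integral>\<^sup>+x. ennreal (sqrt 2) * ennreal (normal_density 0 (sqrt 2 * s) x) \<partial>lborel)"
      using assms(1) by (intro nn_integral_cong)
        (simp flip: ennreal_mult add: normal_density_times_exp_square)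
    also have "\<dots> = ennreal (sqrt 2)"
      using assms(1) by (subst nn_integral_cmult) (auto simp: nn_integral_eq_integral)
    finally show ?thesis .
  qed
  let ?E = "{\<omega> \<in> space P. ennreal (exp (real (card L))) \<le> (\<Prod>l\<in>L. ennreal (exp ((G l \<omega>)\<^sup>2 / (4 * s\<^sup>2))))}"
  have "{\<omega> \<in> space P. 4 * real (card L) * s\<^sup>2 < (\<Sum>l\<in>L. (G l \<omega>)\<^sup>2)} \<subseteq> ?E"
  proof safe
    fix \<omega> assume "4 * real (card L) * s\<^sup>2 < (\<Sum>l\<in>L. (G l \<omega>)\<^sup>2)"
    then have "real (card L) \<le> (\<Sum>l\<in>L. (G l \<omega>)\<^sup>2 / (4 * s\<^sup>2))"
      using assms(1) by (simp add: field_simps flip: sum_divide_distrib)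
    then show "ennreal (exp (real (card L))) \<le> (\<Prod>l\<in>L. ennreal (exp ((G l \<omega>)\<^sup>2 / (4 * s\<^sup>2))))"
      using \<open>finite L\<close> by (simp add: prod_ennreal exp_sum[symmetric])
  qed
  then have "emeasure P {\<omega> \<in> space P. 4 * real (card L) * s\<^sup>2 < (\<Sum>l\<in>L. (G l \<omega>)\<^sup>2)} \<le> emeasure P ?E"
    by (rule emeasure_mono) measurable
  also have "\<dots> = emeasure P {\<omega> \<in> space P. 1 \<le> ennreal (exp (- real (card L))) *
      (\<Prod>l\<in>L. ennreal (exp ((G l \<omega>)\<^sup>2 / (4 * s\<^sup>2))))}"
    by (intro arg_cong[where f="emeasure P"] Collect_cong conj_cong refl)
       (simp add: prod_ennreal prod_nonneg exp_minus field_simps flip: ennreal_mult ennreal_1)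
  also have "\<dots> \<le> ennreal (exp (- real (card L))) *
      (\<integral>\<^sup>+\<omega>. (\<Prod>l\<in>L. ennreal (exp ((G l \<omega>)\<^sup>2 / (4 * s\<^sup>2)))) * indicator (space P) \<omega> \<partial>P)"
    by (rule order_trans[OF _ nn_integral_Markov_inequality]) auto
  also have "(\<integral>\<^sup>+\<omega>. (\<Prod>l\<in>L. ennreal (exp ((G l \<omega>)\<^sup>2 / (4 * s\<^sup>2)))) * indicator (space P) \<omega> \<partial>P) =
      (\<integral>\<^sup>+\<omega>. (\<Prod>l\<in>L. ennreal (exp ((G l \<omega>)\<^sup>2 / (4 * s\<^sup>2)))) \<partial>P)"
    by (intro nn_integral_cong) auto
  also have "\<dots> = (\<Prod>l\<in>L. (\<integral>\<^sup>+\<omega>. ennreal (exp ((G l \<omega>)\<^sup>2 / (4 * s\<^sup>2))) \<partial>P))"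
    by (rule indep_vars_nn_integral[OF \<open>finite L\<close> ind]) auto
  also have "\<dots> = ennreal (sqrt 2 ^ card L)"
    by (simp add: mgf ennreal_power)
  also have "ennreal (exp (- real (card L))) * \<dots> = ennreal ((sqrt 2 * exp (-1)) ^ card L)"
    by (simp add: power_mult_distrib mult.commute flip: ennreal_mult exp_of_nat_mult)
  finally show "prob {\<omega> \<in> space P. 4 * real (card L) * s\<^sup>2 < (\<Sum>l\<in>L. (\<Sum>i\<in>K l. a l i * \<omega> i)\<^sup>2)}
    \<le> (sqrt 2 * exp (-1)) ^ card L"
    unfolding G_def by (simp add: emeasure_eq_measure)
qed

lemma sum_squares_coordinates_tail:
  assumes "0 < s" "finite I"
  defines "P \<equiv> PiM I (\<lambda>_. gaussian s)"
  defines "E \<equiv> {\<omega> \<in> space P. 4 * real (card I) * s\<^sup>2 < (\<Sum>i\<in>I. (\<omega> i)\<^sup>2)}"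
  shows "E \<in> sets P" and "measure P E \<le> (sqrt 2 * exp (-1)) ^ card I"
proof -
  have "E = {\<omega> \<in> space P. 4 * real (card I) * s\<^sup>2 < (\<Sum>l\<in>I. (\<Sum>i\<in>{l}. 1 * \<omega> i)\<^sup>2)}"
    by (simp add: E_def)
  moreover have "\<dots> \<in> sets P \<and> measure P \<dots> \<le> (sqrt 2 * exp (-1)) ^ card I"
    unfolding P_def using assms(1,2)
    by (intro conjI sum_squares_tail) (auto simp: disjoint_family_on_def)
  ultimately show "E \<in> sets P" "measure P E \<le> (sqrt 2 * exp (-1)) ^ card I" by auto
qed

lemma norm2_sq: "(norm2 n u)\<^sup>2 = (\<Sum>i<n. (u i)\<^sup>2)"
  by (simp add: norm2_def L2_set_def sum_nonneg)

lemma norm2_nonneg [simp]: "0 \<le> norm2 n u"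
  by (simp add: norm2_def)

text \<open>
  The coordinates of \<open>X \<beta>\<close>, divided by \<open>sqrt k\<close>, are unit combinations of disjoint rows.
\<close>
lemma norm2_design_signal_tail:
  fixes n p :: nat and \<beta> :: "nat \<Rightarrow> real"
  assumes "binary_sparse p k \<beta>" "0 < k"
  defines "P \<equiv> PiM ({..<n} \<times> {..<p}) (\<lambda>_. gaussian 1)"
  defines "E \<equiv> {X \<in> space P. 4 * real n * real k < (norm2 n (mat_vec p X \<beta>))\<^sup>2}"
  shows "E \<in> sets P" and "measure P E \<le> (sqrt 2 * exp (-1)) ^ n"
proof -
  let ?a = "\<lambda>ij. \<beta> (snd ij) / sqrt (real k)"
  have row: "(\<Sum>ij\<in>{i} \<times> {..<p}. f ij) = (\<Sum>j<p. f (i, j))" for i and f :: "nat \<times> nat \<Rightarrow> real"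
  proof -
    have "{i} \<times> {..<p} = (\<lambda>j. (i, j)) ` {..<p}" by auto
    then show ?thesis by (simp add: sum.reindex inj_on_def)
  qed
  have "(\<Sum>j<p. (\<beta> j)\<^sup>2) = (\<Sum>j\<in>{j. j < p \<and> \<beta> j \<noteq> 0}. 1)"
    using assms(1) by (intro sum.mono_neutral_cong_right) (auto simp: binary_sparse_def)
  then have \<beta>2: "(\<Sum>j<p. (\<beta> j)\<^sup>2) = real k"
    using assms(1) by (simp add: binary_sparse_def)
  have unit: "(\<Sum>ij\<in>{i} \<times> {..<p}. (?a ij)\<^sup>2) = 1" for i :: nat
    using \<beta>2 \<open>0 < k\<close> unfolding row by (simp add: power_divide flip: sum_divide_distrib)
  have "(\<Sum>ij\<in>{i} \<times> {..<p}. ?a ij * X ij) = mat_vec p X \<beta> i / sqrt (real k)" for i X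
    unfolding row mat_vec_def sum_divide_distrib by (intro sum.cong) auto
  then have "(\<Sum>i<n. (\<Sum>ij\<in>{i} \<times> {..<p}. ?a ij * X ij)\<^sup>2) = (norm2 n (mat_vec p X \<beta>))\<^sup>2 / real k" for X
    using \<open>0 < k\<close> unfolding norm2_sq by (simp add: power_divide flip: sum_divide_distrib)
  then have E: "E = {X \<in> space P. 4 * real (card {..<n}) * 1\<^sup>2 < (\<Sum>i\<in>{..<n}. (\<Sum>ij\<in>{i} \<times> {..<p}. ?a ij * X ij)\<^sup>2)}"
    using \<open>0 < k\<close> by (auto simp: E_def less_divide_eq)
  have "E \<in> sets P \<and> measure P E \<le> (sqrt 2 * exp (-1)) ^ card {..<n}"
    unfolding E P_def
    by (intro conjI sum_squares_tail unit) (auto simp: disjoint_family_on_def)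
  then show "E \<in> sets P" "measure P E \<le> (sqrt 2 * exp (-1)) ^ n" by auto
qed

text \<open>
  The density on \<open>{b..b + 1}\<close> is at least its value at \<open>b + 1\<close>, and \<open>(b + 1)\<^sup>2 \<le> 2 * b\<^sup>2 + 2\<close>.
  The loss in the exponent is harmless because only \<open>b\<^sup>2 = ln p / 4\<close> is used below, where it costs
  a power of \<open>p\<close> smaller than one.
\<close>
lemma normal_upper_tail_ge:
  assumes "0 \<le> b"
  shows "exp (- (b\<^sup>2) - 1) / 4 \<le> measure (gaussian 1) {b..}"
proof -
  interpret prob_space "gaussian 1" by (rule prob_space_gaussian) simp
  have "ennreal (exp (- (b\<^sup>2) - 1) / 4) = (\<integral>\<^sup>+x\<in>{b..b+1}. ennreal (exp (- (b\<^sup>2) - 1) / 4) \<partial>lborel)"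
    by (simp add: nn_integral_cmult_indicator)
  also have "\<dots> \<le> (\<integral>\<^sup>+x\<in>{b..b+1}. ennreal (normal_density 0 1 x) \<partial>lborel)"
  proof (intro nn_integral_mono)
    fix x :: real
    have "exp (- (b\<^sup>2) - 1) / 4 \<le> normal_density 0 1 x" if x: "b \<le> x" "x \<le> b + 1"
    proof -
      have "x\<^sup>2 \<le> (b + 1)\<^sup>2" using assms x by (intro power_mono) auto
      also have "\<dots> \<le> 2 * b\<^sup>2 + 2"
        using zero_le_power2[of "b - 1"] by (simp add: power2_eq_square algebra_simps)
      finally have 1: "exp (- (b\<^sup>2) - 1) \<le> exp (- (x\<^sup>2) / 2)" by simp
      have "sqrt (2 * pi) \<le> sqrt 16" using pi_less_4 by (intro real_sqrt_le_mono) auto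
      then have 2: "1 / 4 \<le> 1 / sqrt (2 * pi)" by (intro divide_left_mono) auto
      have "1 / 4 * exp (- (b\<^sup>2) - 1) \<le> 1 / sqrt (2 * pi) * exp (- (x\<^sup>2) / 2)"
        using 1 2 by (intro mult_mono) auto
      then show ?thesis by (simp add: normal_density_def)
    qed
    then show "ennreal (exp (- (b\<^sup>2) - 1) / 4) * indicator {b..b+1} x
        \<le> ennreal (normal_density 0 1 x) * indicator {b..b+1} x"
      by (auto simp: indicator_def intro!: ennreal_leI)
  qed
  also have "\<dots> \<le> (\<integral>\<^sup>+x\<in>{b..}. ennreal (normal_density 0 1 x) \<partial>lborel)"
    by (intro nn_integral_mono) (auto simp: indicator_def)
  also have "\<dots> = emeasure (gaussian 1) {b..}"
    by (simp add: gaussian_def emeasure_density)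
  finally show ?thesis by (simp add: emeasure_eq_measure)
qed

section \<open>Columns correlated with every direction\<close>

text \<open>
  Asking for one good column in each of \<open>s\<close> disjoint blocks, and not for \<open>s\<close> good columns anywhere,
  replaces the tail of a binomial law by products of \<open>q\<close> equal probabilities.
\<close>
definition correlated_blocks ::
  "real \<Rightarrow> nat \<Rightarrow> nat \<Rightarrow> nat \<Rightarrow> (nat \<times> nat \<Rightarrow> real) \<Rightarrow> (nat \<Rightarrow> real) \<Rightarrow> bool" where
  "correlated_blocks a n q s X u \<longleftrightarrow>
     (\<forall>t<s. \<exists>j\<in>{t * q..<Suc t * q}. a * norm2 n u \<le> (\<Sum>i<n. X (i, j) * u i))"

lemma inner_le_norm2: "(\<Sum>i<n. u i * v i) \<le> norm2 n u * norm2 n v"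
proof -
  have "(\<Sum>i<n. u i * v i) \<le> (\<Sum>i<n. \<bar>u i\<bar> * \<bar>v i\<bar>)"
    by (intro sum_mono) (metis abs_ge_self abs_mult)
  also have "\<dots> \<le> norm2 n u * norm2 n v"
    unfolding norm2_def by (rule L2_set_mult_ineq)
  finally show ?thesis .
qed

text \<open>
  Passing from lattice vectors to all vectors.  Scale \<open>u\<close> to length \<open>N\<close> and round its entries: this
  changes an inner product with a column by at most \<open>n * R\<close> and the length by at most \<open>n\<close>, which
  are small parts of \<open>b * N\<close> and of \<open>N\<close>.  Half of \<open>b\<close> is lost to the shorter length
  and another quarter to the change of the inner product.
\<close>
lemma correlated_blocks_from_lattice:
  fixes N :: nat
  assumes "0 < q" "0 < n" "0 < b"
    and N: "2 * real n \<le> real N" "4 * real n * R \<le> b * real N"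
    and entries: "\<And>i j. i < n \<Longrightarrow> j < s * q \<Longrightarrow> \<bar>X (i, j)\<bar> \<le> R"
    and lattice: "\<And>m. m \<in> {..<n} \<rightarrow>\<^sub>E {- int N..int N} \<Longrightarrow> norm2 n (\<lambda>i. of_int (m i)) \<noteq> 0 \<Longrightarrow>
      correlated_blocks b n q s X (\<lambda>i. of_int (m i))"
  shows "correlated_blocks (b / 4) n q s X u"
proof (cases "norm2 n u = 0")
  case True
  then have "\<forall>i<n. u i = 0"
    by (simp add: norm2_def L2_set_def sum_nonneg_eq_0_iff)
  then show ?thesis
    using assms(1) True by (auto simp: correlated_blocks_def intro!: bexI[of _ "_ * q"])
next
  case False
  define \<rho> where "\<rho> = norm2 n u"
  have \<rho>: "0 < \<rho>" using False norm2_nonneg[of n u] unfolding \<rho>_def by linarith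
  have N0: "0 < real N" using N(1) assms(2) by linarith
  define w where "w i = real N * (u i / \<rho>)" for i
  define m where "m = (\<lambda>i\<in>{..<n}. \<lfloor>w i\<rfloor>)"
  have w_bound: "\<bar>w i\<bar> \<le> real N" if "i < n" for i
  proof -
    have "(u i)\<^sup>2 \<le> (\<Sum>i<n. (u i)\<^sup>2)"
      using that by (intro member_le_sum) auto
    then have "\<bar>u i\<bar> \<le> \<rho>"
      unfolding norm2_sq[symmetric] \<rho>_def by (metis abs_le_square_iff abs_of_nonneg norm2_nonneg)
    then show ?thesis using \<rho> N0 by (simp add: w_def abs_mult divide_le_eq)
  qed
  have m_in: "m \<in> {..<n} \<rightarrow>\<^sub>E {- int N..int N}"
  proof (rule PiE_I)
    fix i assume "i \<in> {..<n}"
    then have "\<bar>w i\<bar> \<le> real N" using w_bound by auto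
    then have "- int N \<le> \<lfloor>w i\<rfloor>" "\<lfloor>w i\<rfloor> \<le> int N" by linarith+
    then show "m i \<in> {- int N..int N}" using \<open>i \<in> {..<n}\<close> by (simp add: m_def)
  qed (simp add: m_def)
  have close: "\<bar>of_int (m i) - w i\<bar> \<le> 1" if "i < n" for i
    using that unfolding m_def by simp linarith
  have norm_w: "norm2 n w = real N"
  proof -
    have "norm2 n w = real N / \<rho> * norm2 n u"
      using \<rho> N0 unfolding norm2_def w_def
      by (subst L2_set_right_distrib) (auto intro!: L2_set_cong)
    then show ?thesis using \<rho> by (simp add: \<rho>_def)
  qed
  have "norm2 n w \<le> norm2 n (\<lambda>i. of_int (m i)) + norm2 n (\<lambda>i. w i - of_int (m i))"
    using L2_set_triangle_ineq[of "\<lambda>i. of_int (m i)" "\<lambda>i. w i - of_int (m i)" "{..<n}"]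
    by (simp add: norm2_def)
  moreover have "norm2 n (\<lambda>i. w i - of_int (m i)) \<le> (\<Sum>i<n. 1)"
    unfolding norm2_def using close
    by (intro order_trans[OF L2_set_le_sum_abs] sum_mono) (auto simp: abs_minus_commute)
  ultimately have norm_m: "real N / 2 \<le> norm2 n (\<lambda>i. of_int (m i))"
    using norm_w N(1) by simp
  then have "correlated_blocks b n q s X (\<lambda>i. of_int (m i))"
    using N0 by (intro lattice m_in) auto
  show ?thesis unfolding correlated_blocks_def
  proof (intro allI impI)
    fix t assume "t < s"
    then obtain j where j: "j \<in> {t * q..<Suc t * q}"
      "b * norm2 n (\<lambda>i. of_int (m i)) \<le> (\<Sum>i<n. X (i, j) * of_int (m i))"
      using \<open>correlated_blocks b n q s X _\<close> unfolding correlated_blocks_def by blast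
    have "Suc t * q \<le> s * q" using \<open>t < s\<close> by (intro mult_le_mono1) auto
    then have js: "j < s * q" using j(1) by auto
    have "(\<Sum>i<n. X (i, j) * of_int (m i)) - (\<Sum>i<n. X (i, j) * w i) =
        (\<Sum>i<n. X (i, j) * (of_int (m i) - w i))"
      by (simp add: sum_subtractf right_diff_distrib)
    also have "\<dots> \<le> (\<Sum>i<n. R)"
    proof (intro sum_mono)
      fix i assume "i \<in> {..<n}"
      then have "\<bar>X (i, j)\<bar> * \<bar>of_int (m i) - w i\<bar> \<le> R * 1"
        using entries[of i j] close[of i] js by (intro mult_mono) auto
      then show "X (i, j) * (of_int (m i) - w i) \<le> R"
        by (metis abs_mult abs_le_D1 mult.right_neutral)
    qed
    also have "\<dots> \<le> b * real N / 4" using N(2) by simp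
    finally have "b * norm2 n (\<lambda>i. of_int (m i)) - b * real N / 4 \<le> (\<Sum>i<n. X (i, j) * w i)"
      using j(2) by linarith
    moreover have "b * (real N / 2) \<le> b * norm2 n (\<lambda>i. of_int (m i))"
      using norm_m assms(3) by (intro mult_left_mono) auto
    ultimately have "b * real N / 4 \<le> (\<Sum>i<n. X (i, j) * w i)" by linarith
    also have "\<dots> = real N / \<rho> * (\<Sum>i<n. X (i, j) * u i)"
      by (simp add: w_def sum_distrib_left mult_ac)
    finally have "b / 4 * norm2 n u \<le> (\<Sum>i<n. X (i, j) * u i)"
      using \<rho> N0 by (simp add: \<rho>_def field_simps)
    then show "\<exists>j\<in>{t * q..<Suc t * q}. b / 4 * norm2 n u \<le> (\<Sum>i<n. X (i, j) * u i)"
      using j(1) by blast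
  qed
qed

lemma sum_column: "(\<Sum>ij\<in>A \<times> {j}. f ij) = (\<Sum>i\<in>A. f (i, j))"
proof -
  have "A \<times> {j} = (\<lambda>i. (i, j)) ` A" by auto
  then show ?thesis by (simp add: sum.reindex inj_on_def)
qed

lemma block_uncorrelated_prob:
  fixes m :: "nat \<Rightarrow> real" and n p :: nat
  assumes "0 \<le> b" "norm2 n m \<noteq> 0" "finite J" "J \<noteq> {}" "J \<subseteq> {..<p}"
  defines "P \<equiv> PiM ({..<n} \<times> {..<p}) (\<lambda>_. gaussian 1)"
  shows "measure P {X \<in> space P. \<forall>j\<in>J. (\<Sum>i<n. X (i, j) * m i) < b * norm2 n m}
    \<le> (1 - exp (- (b\<^sup>2) - 1) / 4) ^ card J"
proof -
  interpret prob_space P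
    unfolding P_def by (intro prob_space_PiM prob_space_gaussian) simp
  define \<rho> where "\<rho> = norm2 n m"
  have \<rho>: "0 < \<rho>" using assms(2) norm2_nonneg[of n m] unfolding \<rho>_def by linarith
  define G where "G j X = (\<Sum>ij\<in>{..<n} \<times> {j}. (m (fst ij) / \<rho>) * X ij)" for j :: nat and X :: "nat \<times> nat \<Rightarrow> real"
  have G_eq: "G j X = (\<Sum>i<n. X (i, j) * m i) / \<rho>" for j X
    unfolding G_def sum_column sum_divide_distrib by (intro sum.cong) simp_all
  have ind: "indep_vars (\<lambda>_. borel) G J"
    unfolding G_def P_def using assms(5)
    by (intro indep_vars_combinations) (auto simp: disjoint_family_on_def)
  have dis: "distributed P lborel (G j) (normal_density 0 1)" if "j \<in> J" for j
    unfolding G_def P_def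
  proof (rule distributed_unit_combination)
    have "(\<Sum>ij\<in>{..<n} \<times> {j}. (m (fst ij) / \<rho>)\<^sup>2) = (\<Sum>i<n. (m i)\<^sup>2) / \<rho>\<^sup>2"
      unfolding sum_column sum_divide_distrib by (simp add: power_divide)
    also have "\<dots> = (norm2 n m)\<^sup>2 / \<rho>\<^sup>2" unfolding norm2_sq ..
    also have "\<dots> = 1" using \<rho> by (simp add: \<rho>_def)
    finally show "(\<Sum>ij\<in>{..<n} \<times> {j}. (m (fst ij) / \<rho>)\<^sup>2) = 1" .
  qed (use that assms(5) in auto)
  have mG: "G j \<in> borel_measurable P" if "j \<in> J" for j
    using distributed_measurable[OF dis[OF that]] by simp
  have fail: "prob (G j -` {..<b} \<inter> space P) \<le> 1 - exp (- (b\<^sup>2) - 1) / 4" if "j \<in> J" for j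
  proof -
    have "prob (G j -` {b..} \<inter> space P) = measure (distr P lborel (G j)) {b..}"
      using mG[OF that] by (subst measure_distr) auto
    also have "distr P lborel (G j) = gaussian 1"
      using dis[OF that] by (simp add: distributed_def gaussian_def)
    finally have "exp (- (b\<^sup>2) - 1) / 4 \<le> prob (G j -` {b..} \<inter> space P)"
      using normal_upper_tail_ge[OF assms(1)] by simp
    moreover have "prob (G j -` {..<b} \<inter> space P) = 1 - prob (G j -` {b..} \<inter> space P)"
    proof -
      have "G j -` {..<b} \<inter> space P = space P - (G j -` {b..} \<inter> space P)" by auto
      then show ?thesis
        using prob_compl[OF measurable_sets[OF mG[OF that], of "{b..}"]] by simp
    qed
    ultimately show ?thesis by linarith
  qed
  have "{X \<in> space P. \<forall>j\<in>J. (\<Sum>i<n. X (i, j) * m i) < b * norm2 n m} =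
      (\<Inter>j\<in>J. G j -` {..<b} \<inter> space P)"
    using \<rho> \<open>J \<noteq> {}\<close> by (auto simp: G_eq \<rho>_def divide_less_eq)
  then have "prob {X \<in> space P. \<forall>j\<in>J. (\<Sum>i<n. X (i, j) * m i) < b * norm2 n m} =
      (\<Prod>j\<in>J. prob (G j -` {..<b} \<inter> space P))"
    using indep_varsD[OF ind assms(4,3) order_refl, of "\<lambda>_. {..<b}"] by simp
  also have "\<dots> \<le> (\<Prod>j\<in>J. 1 - exp (- (b\<^sup>2) - 1) / 4)"
    by (intro prod_mono) (auto intro: fail)
  finally show ?thesis by simp
qed

lemma lattice_uncorrelated_prob:
  fixes n p q s N :: nat
  assumes "0 \<le> b" "0 < q" "s * q \<le> p"
  defines "P \<equiv> PiM ({..<n} \<times> {..<p}) (\<lambda>_. gaussian 1)"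
  defines "\<Lambda> \<equiv> {m \<in> {..<n} \<rightarrow>\<^sub>E {- int N..int N}. norm2 n (\<lambda>i. of_int (m i)) \<noteq> 0}"
  shows "measure P {X \<in> space P. \<exists>m\<in>\<Lambda>. \<not> correlated_blocks b n q s X (\<lambda>i. of_int (m i))}
    \<le> real ((2 * N + 1) ^ n * s) * (1 - exp (- (b\<^sup>2) - 1) / 4) ^ q" (is "_ \<le> _ * ?\<delta>")
    and "{X \<in> space P. \<exists>m\<in>\<Lambda>. \<not> correlated_blocks b n q s X (\<lambda>i. of_int (m i))} \<in> sets P"
proof -
  interpret prob_space P
    unfolding P_def by (intro prob_space_PiM prob_space_gaussian) simp
  define F where "F m t = {X \<in> space P. \<forall>j\<in>{t * q..<Suc t * q}.
    (\<Sum>i<n. X (i, j) * of_int (m i)) < b * norm2 n (\<lambda>i. of_int (m i))}" for m :: "nat \<Rightarrow> int" and t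
  have block: "{t * q..<Suc t * q} \<subseteq> {..<p}" if "t < s" for t
  proof -
    have "Suc t * q \<le> s * q" using that by (intro mult_le_mono1) auto
    then show ?thesis using assms(3) by auto
  qed
  have coord: "(\<lambda>X. X (i, j)) \<in> borel_measurable P" if "i < n" "j < p" for i j
  proof -
    have "(i, j) \<in> {..<n} \<times> {..<p}" using that by simp
    from distributed_measurable[OF distributed_coordinate[OF zero_less_one this]]
    show ?thesis unfolding P_def by simp
  qed
  have F_meas: "F m t \<in> events" if "t < s" for m t
  proof -
    have "(\<lambda>X. \<Sum>i<n. X (i, j) * of_int (m i)) \<in> borel_measurable P" if "j \<in> {t * q..<Suc t * q}" for j
      using block[OF \<open>t < s\<close>] that by (intro borel_measurable_sum borel_measurable_times coord) auto
    then have "{X \<in> space P. (\<Sum>i<n. X (i, j) * of_int (m i)) < b * norm2 n (\<lambda>i. of_int (m i))} \<in> events"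
      if "j \<in> {t * q..<Suc t * q}" for j
      using that by measurable
    then show ?thesis
      unfolding F_def by (intro sets.sets_Collect_finite_All') (use \<open>0 < q\<close> in auto)
  qed
  have fin: "finite \<Lambda>" unfolding \<Lambda>_def by (rule finite_Collect_conjI) (simp add: finite_PiE)
  have "card \<Lambda> \<le> card ({..<n} \<rightarrow>\<^sub>E {- int N..int N})"
    unfolding \<Lambda>_def by (intro card_mono finite_PiE) auto
  also have "\<dots> = (2 * N + 1) ^ n"
  proof -
    have "nat (int N - - int N + 1) = 2 * N + 1" by linarith
    then have "card {- int N..int N} = 2 * N + 1" by (subst card_atLeastAtMost_int)
    then show ?thesis by (subst card_PiE) (simp_all only: prod_constant card_lessThan finite_lessThan)
  qed
  finally have card: "card (\<Lambda> \<times> {..<s}) \<le> (2 * N + 1) ^ n * s"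
    by (simp add: card_cartesian_product)
  have eq: "{X \<in> space P. \<exists>m\<in>\<Lambda>. \<not> correlated_blocks b n q s X (\<lambda>i. of_int (m i))} =
      (\<Union>(m, t)\<in>\<Lambda> \<times> {..<s}. F m t)"
    unfolding correlated_blocks_def F_def by (auto simp: not_le)
  show "{X \<in> space P. \<exists>m\<in>\<Lambda>. \<not> correlated_blocks b n q s X (\<lambda>i. of_int (m i))} \<in> sets P"
    unfolding eq using fin by (intro sets.finite_UN) (auto intro: F_meas)
  have \<delta>0: "0 \<le> ?\<delta>"
  proof -
    have "- (b\<^sup>2) - 1 \<le> 0" using zero_le_power2[of b] by linarith
    then have "exp (- (b\<^sup>2) - 1) \<le> 1" by simp
    then show ?thesis by (intro zero_le_power) linarith
  qed
  have "prob (\<Union>(m, t)\<in>\<Lambda> \<times> {..<s}. F m t) \<le> (\<Sum>mt\<in>\<Lambda> \<times> {..<s}. prob (case mt of (m, t) \<Rightarrow> F m t))"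
    using fin by (intro finite_measure_subadditive_finite) (auto intro: F_meas)
  also have "\<dots> \<le> (\<Sum>mt\<in>\<Lambda> \<times> {..<s}. ?\<delta>)"
  proof (intro sum_mono, safe)
    fix m t assume m: "m \<in> \<Lambda>" and t: "t < s"
    have "prob (F m t) \<le> (1 - exp (- (b\<^sup>2) - 1) / 4) ^ card {t * q..<Suc t * q}"
      unfolding F_def P_def using m block[OF t] assms
      by (intro block_uncorrelated_prob) (auto simp: \<Lambda>_def)
    then show "prob (F m t) \<le> ?\<delta>" by simp
  qed
  also have "\<dots> = real (card (\<Lambda> \<times> {..<s})) * ?\<delta>" by simp
  also have "\<dots> \<le> real ((2 * N + 1) ^ n * s) * ?\<delta>"
    using card \<delta>0 by (intro mult_right_mono of_nat_mono)
  finally show "measure P {X \<in> space P. \<exists>m\<in>\<Lambda>. \<not> correlated_blocks b n q s X (\<lambda>i. of_int (m i))}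
    \<le> real ((2 * N + 1) ^ n * s) * ?\<delta>" unfolding eq .
qed

section \<open>Optimal solutions have small norm\<close>

lemma mat_vec_convex:
  "mat_vec p X (\<lambda>j. (1 - t) * b j + t * v j) i = (1 - t) * mat_vec p X b i + t * mat_vec p X v i"
  unfolding mat_vec_def sum_distrib_left sum.distrib[symmetric]
  by (intro sum.cong refl) (simp add: algebra_simps)

text \<open>
  First-order optimality along the segment from \<open>b\<close> to \<open>v\<close>.  The correlation hypothesis says that
  the squared residual has nonpositive slope at \<open>b\<close>: with \<open>X b = Y - r\<close>, the inner product of \<open>r\<close>
  and \<open>X v - X b\<close> is at least \<open>norm2 n r ^ 2\<close> by Cauchy--Schwarz.  A \<open>v\<close> of smaller \<open>\<ell>\<^sub>1\<close> norm
  would decrease the penalty at a linear rate, against a quadratic increase of the residual.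
\<close>
lemma lasso_norm1_le:
  fixes Y :: "nat \<Rightarrow> real" and p :: nat and X :: "nat \<times> nat \<Rightarrow> real"
  defines "r \<equiv> \<lambda>b i. Y i - mat_vec p X b i"
  assumes "0 < n" "0 < lam"
    and opt: "\<And>t. 0 < t \<Longrightarrow> t \<le> 1 \<Longrightarrow>
      lasso_objective n p X Y lam b \<le> lasso_objective n p X Y lam (\<lambda>j. (1 - t) * b j + t * v j)"
    and corr: "norm2 n Y * norm2 n (r b) \<le> (\<Sum>i<n. r b i * mat_vec p X v i)"
  shows "norm1 p b \<le> norm1 p v"
proof (rule ccontr)
  assume larger: "\<not> ?thesis"
  define g where "g = norm1 p b - norm1 p v"
  have g: "0 < g" using larger by (simp add: g_def)
  define d where "d i = mat_vec p X v i - mat_vec p X b i" for i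
  define D where "D = (norm2 n d)\<^sup>2 / real n"
  have D: "0 \<le> D" by (simp add: D_def)
  have inner: "0 \<le> (\<Sum>i<n. r b i * d i)"
  proof -
    have "(\<Sum>i<n. r b i * d i) = (\<Sum>i<n. r b i * mat_vec p X v i) - (\<Sum>i<n. Y i * r b i) + (norm2 n (r b))\<^sup>2"
      unfolding norm2_sq d_def r_def
      by (simp add: sum_subtractf[symmetric] sum.distrib[symmetric] power2_eq_square algebra_simps)
    moreover have "(\<Sum>i<n. Y i * r b i) \<le> norm2 n Y * norm2 n (r b)"
      by (rule inner_le_norm2)
    ultimately show ?thesis using corr zero_le_power2[of "norm2 n (r b)"] by linarith
  qed
  (* the gain is lam * g * t and the loss D * t^2, so the gain wins once t * D < lam * g *)
  define t where "t = min 1 (lam * g / (D + 1))"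
  have t: "0 < t" "t \<le> 1" using g D \<open>0 < lam\<close> by (auto simp: t_def)
  define bt where "bt = (\<lambda>j. (1 - t) * b j + t * v j)"
  have "(norm2 n (\<lambda>i. Y i - mat_vec p X bt i))\<^sup>2 =
      (norm2 n (r b))\<^sup>2 - 2 * t * (\<Sum>i<n. r b i * d i) + t\<^sup>2 * (norm2 n d)\<^sup>2"
    unfolding norm2_sq bt_def mat_vec_convex sum_distrib_left sum_subtractf[symmetric] sum.distrib[symmetric]
    by (intro sum.cong refl) (simp add: r_def d_def power2_eq_square algebra_simps)
  also have "\<dots> \<le> (norm2 n (r b))\<^sup>2 + t\<^sup>2 * (norm2 n d)\<^sup>2"
    using inner t by simp
  finally have fit: "(norm2 n (\<lambda>i. Y i - mat_vec p X bt i))\<^sup>2 / real n \<le> (norm2 n (r b))\<^sup>2 / real n + t\<^sup>2 * D"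
    using \<open>0 < n\<close> by (simp add: D_def field_simps)
  have "norm1 p bt \<le> (\<Sum>j<p. (1 - t) * \<bar>b j\<bar> + t * \<bar>v j\<bar>)"
    unfolding norm1_def bt_def
  proof (intro sum_mono)
    fix j
    have "\<bar>(1 - t) * b j + t * v j\<bar> \<le> \<bar>(1 - t) * b j\<bar> + \<bar>t * v j\<bar>" by (rule abs_triangle_ineq)
    then show "\<bar>(1 - t) * b j + t * v j\<bar> \<le> (1 - t) * \<bar>b j\<bar> + t * \<bar>v j\<bar>"
      using t by (simp add: abs_mult)
  qed
  also have "\<dots> = norm1 p b - t * g"
    unfolding g_def norm1_def sum.distrib sum_distrib_left[symmetric] by (simp add: algebra_simps)
  finally have "lam * norm1 p bt \<le> lam * (norm1 p b - t * g)"
    using \<open>0 < lam\<close> by (intro mult_left_mono) auto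
  moreover have "(norm2 n (r b))\<^sup>2 / real n + lam * norm1 p b
      \<le> (norm2 n (\<lambda>i. Y i - mat_vec p X bt i))\<^sup>2 / real n + lam * norm1 p bt"
    using opt[OF t] unfolding lasso_objective_def bt_def r_def .
  ultimately have "lam * (t * g) \<le> t\<^sup>2 * D"
    using fit by (simp add: right_diff_distrib)
  then have "t * (lam * g) \<le> t * (t * D)" by (simp add: power2_eq_square mult_ac)
  then have "lam * g \<le> t * D" using t by simp
  also have "\<dots> \<le> lam * g / (D + 1) * D"
    using D by (intro mult_right_mono) (auto simp: t_def)
  also have "\<dots> < lam * g" using D g \<open>0 < lam\<close> by (simp add: field_simps)
  finally show False by simp
qed

text \<open>
  The columns chosen in the blocks are distinct, because the blocks are disjoint.  Hence the sum of
  the chosen columns is \<open>X v\<close> for an indicator \<open>v\<close>, and \<open>v\<close> lies in the box.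
\<close>
lemma correlated_blocks_selection:
  assumes "correlated_blocks a n q s X u" "s * q \<le> p"
  obtains v where "\<And>j. v j \<in> {0, 1::real}" "norm1 p v = real s"
    "real s * a * norm2 n u \<le> (\<Sum>i<n. u i * mat_vec p X v i)"
proof -
  obtain f where f: "\<And>t. t < s \<Longrightarrow> f t \<in> {t * q..<Suc t * q}"
    and f_corr: "\<And>t. t < s \<Longrightarrow> a * norm2 n u \<le> (\<Sum>i<n. X (i, f t) * u i)"
    using assms(1) unfolding correlated_blocks_def by metis
  have div: "f t div q = t" if "t < s" for t
    using f[OF that] by (intro div_nat_eqI) (auto simp: mult.commute)
  have inj: "inj_on f {..<s}"
    by (rule inj_on_inverseI[where g="\<lambda>j. j div q"]) (auto simp: div)
  have sub: "f ` {..<s} \<subseteq> {..<p}"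
  proof safe
    fix t assume "t < s"
    then have "Suc t * q \<le> s * q" by (intro mult_le_mono1) auto
    then show "f t < p" using f[OF \<open>t < s\<close>] assms(2) by auto
  qed
  define v where "v j = (if j \<in> f ` {..<s} then 1 else 0 :: real)" for j
  have sum_v: "(\<Sum>j<p. h j * v j) = (\<Sum>t<s. h (f t))" for h
  proof -
    have "(\<Sum>j<p. h j * v j) = (\<Sum>j\<in>f ` {..<s}. h j * v j)"
      using sub by (intro sum.mono_neutral_right) (auto simp: v_def)
    also have "\<dots> = (\<Sum>t<s. h (f t))"
      by (simp add: sum.reindex[OF inj] v_def)
    finally show ?thesis .
  qed
  show thesis
  proof
    show "v j \<in> {0, 1}" for j by (simp add: v_def)
    have "norm1 p v = (\<Sum>j<p. 1 * v j)" by (simp add: norm1_def v_def)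
    then show "norm1 p v = real s" unfolding sum_v by simp
    have "(\<Sum>i<n. u i * mat_vec p X v i) = (\<Sum>t<s. \<Sum>i<n. X (i, f t) * u i)"
      unfolding mat_vec_def sum_v by (subst sum.swap) (simp add: sum_distrib_left mult.commute)
    also have "\<dots> \<ge> (\<Sum>t<s. a * norm2 n u)"
      by (intro sum_mono f_corr) auto
    finally show "real s * a * norm2 n u \<le> (\<Sum>i<n. u i * mat_vec p X v i)" by simp
  qed
qed

lemma lasso_norm1_le_blocks:
  assumes "0 < n" "0 < lam" "s * q \<le> p"
    and design: "\<And>u. correlated_blocks a n q s X u"
    and Y: "norm2 n Y \<le> real s * a"
  shows "is_LASSO n p X Y lam b \<Longrightarrow> norm1 p b \<le> real s"
    and "is_LASSO_box n p X Y lam b \<Longrightarrow> norm1 p b \<le> real s"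
proof -
  define r where "r = (\<lambda>i. Y i - mat_vec p X b i)"
  obtain v where v: "\<And>j. v j \<in> {0, 1::real}" "norm1 p v = real s"
    "real s * a * norm2 n r \<le> (\<Sum>i<n. r i * mat_vec p X v i)"
    by (rule correlated_blocks_selection[OF design[of r] assms(3)]) blast
  have corr: "norm2 n Y * norm2 n r \<le> (\<Sum>i<n. r i * mat_vec p X v i)"
    using mult_right_mono[OF Y norm2_nonneg[of n r]] v(3) by linarith
  show "norm1 p b \<le> real s" if "is_LASSO n p X Y lam b"
    using that corr v(2) unfolding is_LASSO_def is_arg_min_def r_def
    by (metis (no_types, lifting) lasso_norm1_le[OF assms(1,2)] not_le)
  show "norm1 p b \<le> real s" if box: "is_LASSO_box n p X Y lam b"
  proof -
    have "norm1 p b \<le> norm1 p v"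
    proof (rule lasso_norm1_le[OF assms(1,2)])
      fix t :: real assume t: "0 < t" "t \<le> 1"
      have "(1 - t) * b j + t * v j \<in> {0..1}" if "j < p" for j
      proof -
        have "b j \<in> {0..1}" "v j \<in> {0..1}"
          using box that v(1)[of j] by (auto simp: is_LASSO_box_def is_arg_min_def)
        then show ?thesis
          using t convex_bound_le[of "b j" 1 "v j" "1 - t" t] by auto
      qed
      then show "lasso_objective n p X Y lam b \<le> lasso_objective n p X Y lam (\<lambda>j. (1 - t) * b j + t * v j)"
        using box unfolding is_LASSO_box_def is_arg_min_def by (metis (no_types, lifting) not_le)
    qed (use corr in \<open>simp add: r_def\<close>)
    then show ?thesis using v(2) by simp
  qed
qed

lemma distance_from_binary_ge:
  assumes "binary_sparse p k \<beta>" "norm1 p b \<le> s"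
  shows "real k - s \<le> sqrt (real k) * norm2 p (\<lambda>j. b j - \<beta> j)"
proof -
  define S where "S = {j. j < p \<and> \<beta> j \<noteq> 0}"
  have S: "finite S" "S \<subseteq> {..<p}" "card S = k" "\<And>j. j \<in> S \<Longrightarrow> \<beta> j = 1"
    using assms(1) by (auto simp: S_def binary_sparse_def)
  have "(\<Sum>j\<in>S. \<bar>b j\<bar>) \<le> s"
    using assms(2) S sum_mono2[of "{..<p}" S "\<lambda>j. \<bar>b j\<bar>"] by (simp add: norm1_def)
  moreover have "real k = (\<Sum>j\<in>S. \<beta> j)" using S by simp
  ultimately have "real k - s \<le> (\<Sum>j\<in>S. \<beta> j - \<bar>b j\<bar>)"
    by (simp add: sum_subtractf)
  also have "\<dots> \<le> (\<Sum>j\<in>S. \<bar>1\<bar> * \<bar>b j - \<beta> j\<bar>)"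
    by (intro sum_mono) (auto simp: abs_if)
  also have "\<dots> \<le> L2_set (\<lambda>_. 1) S * L2_set (\<lambda>j. b j - \<beta> j) S"
    by (rule L2_set_mult_ineq)
  also have "L2_set (\<lambda>_. 1) S = sqrt (real k)"
    using S by (simp add: L2_set_def)
  also have "sqrt (real k) * L2_set (\<lambda>j. b j - \<beta> j) S \<le> sqrt (real k) * norm2 p (\<lambda>j. b j - \<beta> j)"
    unfolding norm2_def L2_set_def using S
    by (intro mult_left_mono real_sqrt_le_mono sum_mono2) auto
  finally show ?thesis .
qed

section \<open>Probability that the optimal solutions have small norm\<close>

lemma (in prob_space) prob_avoid3:
  assumes "A \<in> events" "B \<in> events" "C \<in> events"
  shows "1 - (prob A + prob B + prob C) \<le> prob (space M - (A \<union> B \<union> C))"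
  using prob_compl[of "A \<union> B \<union> C"] measure_Un_le[of "A \<union> B" M C] measure_Un_le[of A M B] assms
  by auto

text \<open>
  The design is good outside three events: some entry is large, \<open>X \<beta>\<close> is long, or some lattice
  vector is correlated with no column of some block.  The noise is good unless it is long.
  The entries are controlled through the sum of all their squares, so that the same tail bound
  serves for them, for \<open>X \<beta>\<close> and for the noise.
\<close>
lemma lasso_norm1_small_prob:
  fixes n p k :: nat and \<sigma> lam :: real and \<beta> :: "nat \<Rightarrow> real"
  assumes "2 \<le> k" "k < n" "n \<le> p" "256 \<le> ln (real p)" "0 < \<sigma>" "\<sigma>\<^sup>2 \<le> real k" "0 < lam"
    and bin: "binary_sparse p k \<beta>" and n_upper: "real n \<le> real k * ln (real p) / 10000"
  defines "s \<equiv> k div 2"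
  defines "\<eta> \<equiv> 3 * (sqrt 2 * exp (-1)) ^ n +
    real ((2 * p\<^sup>2 + 1) ^ n * s) * (1 - exp (- (ln (real p) / 4) - 1) / 4) ^ (p div s)"
  shows "with_prob_at_least (model_law n p \<sigma>) (1 - \<eta>)
    (\<lambda>(X, W). \<forall>b. is_LASSO n p X (\<lambda>i. mat_vec p X \<beta> i + W i) lam b \<or>
        is_LASSO_box n p X (\<lambda>i. mat_vec p X \<beta> i + W i) lam b \<longrightarrow> norm1 p b \<le> real s)"
proof -
  let ?\<rho> = "sqrt 2 * exp (-1) :: real"
  have "1 + 1 \<le> exp (1::real)" by (rule exp_ge_add_one_self)
  moreover have "sqrt 2 \<le> sqrt 4" by (intro real_sqrt_le_mono) auto
  ultimately have \<rho>: "0 \<le> ?\<rho>" "?\<rho> \<le> 1" by (auto simp: exp_minus field_simps)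
  have s: "0 < s" "s \<le> k" using \<open>2 \<le> k\<close> by (auto simp: s_def)
  have "k \<le> 3 * s" using \<open>2 \<le> k\<close> unfolding s_def by presburger
  then have k3: "real k \<le> 3 * real s" by linarith
  have p: "2 \<le> p" "0 < p" "k \<le> p" "n > 0" using assms(1-3) by auto
  define q where "q = p div s"
  have q: "0 < q" "s * q \<le> p" using s p by (auto simp: q_def div_greater_zero_iff)
  (* b is four times the correlation a that survives the rounding to the lattice *)
  define b where "b = sqrt (ln (real p)) / 2"
  have "sqrt 256 \<le> sqrt (ln (real p))" using assms(4) by (rule real_sqrt_le_mono)
  then have b: "8 \<le> b" "b\<^sup>2 = ln (real p) / 4"
    using assms(4) by (auto simp: b_def power_divide real_sqrt_eq_iff[of 256 "16^2", symmetric])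
  define P where "P = PiM ({..<n} \<times> {..<p}) (\<lambda>_. gaussian 1)"
  define Q where "Q = PiM {..<n} (\<lambda>_. gaussian \<sigma>)"
  interpret P: prob_space P
    unfolding P_def by (intro prob_space_PiM prob_space_gaussian) simp
  interpret Q: prob_space Q
    unfolding Q_def by (intro prob_space_PiM prob_space_gaussian assms)
  define \<Lambda> where "\<Lambda> = {m \<in> {..<n} \<rightarrow>\<^sub>E {- int (p\<^sup>2)..int (p\<^sup>2)}. norm2 n (\<lambda>i. of_int (m i)) \<noteq> 0}"
  define B1 where "B1 = {X \<in> space P. 4 * real (n * p) < (\<Sum>ij\<in>{..<n} \<times> {..<p}. (X ij)\<^sup>2)}"
  define B2 where "B2 = {X \<in> space P. 4 * real n * real k < (norm2 n (mat_vec p X \<beta>))\<^sup>2}"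
  define B3 where "B3 = {X \<in> space P. \<exists>m\<in>\<Lambda>. \<not> correlated_blocks b n q s X (\<lambda>i. of_int (m i))}"
  define BW where "BW = {W \<in> space Q. 4 * real n * \<sigma>\<^sup>2 < (\<Sum>i<n. (W i)\<^sup>2)}"
  have B1: "B1 \<in> P.events" "P.prob B1 \<le> ?\<rho> ^ n"
  proof -
    have "B1 \<in> P.events" "P.prob B1 \<le> ?\<rho> ^ (n * p)"
      using sum_squares_coordinates_tail[of 1 "{..<n} \<times> {..<p}"] by (auto simp: B1_def P_def)
    moreover have "?\<rho> ^ (n * p) \<le> ?\<rho> ^ n"
      using \<rho> p by (intro power_decreasing) auto
    ultimately show "B1 \<in> P.events" "P.prob B1 \<le> ?\<rho> ^ n" by auto
  qed
  have B2: "B2 \<in> P.events" "P.prob B2 \<le> ?\<rho> ^ n"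
    unfolding B2_def P_def using norm2_design_signal_tail[OF bin] \<open>2 \<le> k\<close> by auto
  have B3: "B3 \<in> P.events"
    "P.prob B3 \<le> real ((2 * p\<^sup>2 + 1) ^ n * s) * (1 - exp (- (b\<^sup>2) - 1) / 4) ^ q"
    unfolding B3_def P_def \<Lambda>_def using b
    by (intro lattice_uncorrelated_prob q; simp)+
  have BW: "BW \<in> Q.events" "Q.prob BW \<le> ?\<rho> ^ n"
    using sum_squares_coordinates_tail[of \<sigma> "{..<n}"] \<open>0 < \<sigma>\<close> by (auto simp: BW_def Q_def)
  define A where "A = space P - (B1 \<union> B2 \<union> B3)"
  define B where "B = space Q - BW"
  have AB: "A \<in> P.events" "B \<in> Q.events"
    unfolding A_def B_def using B1 B2 B3 BW by auto
  have prob_A: "1 - (2 * ?\<rho> ^ n + real ((2 * p\<^sup>2 + 1) ^ n * s) * (1 - exp (- (b\<^sup>2) - 1) / 4) ^ q) \<le> P.prob A"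
    using P.prob_avoid3[OF B1(1) B2(1) B3(1)] B1(2) B2(2) B3(2) unfolding A_def by linarith
  have prob_B: "1 - ?\<rho> ^ n \<le> Q.prob B"
    using Q.prob_compl[OF BW(1)] BW(2) unfolding B_def by linarith
  have "measure (P \<Otimes>\<^sub>M Q) (A \<times> B) = P.prob A * Q.prob B"
    using AB by (simp add: measure_def Q.emeasure_pair_measure_Times enn2real_mult)
  moreover have "0 \<le> (1 - P.prob A) * (1 - Q.prob B)"
    by (intro mult_nonneg_nonneg) auto
  ultimately have "1 - \<eta> \<le> measure (P \<Otimes>\<^sub>M Q) (A \<times> B)"
    using prob_A prob_B unfolding \<eta>_def b(2) q_def by (simp add: algebra_simps)
  moreover have "A \<times> B \<in> sets (P \<Otimes>\<^sub>M Q)" using AB by simp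
  moreover have "norm1 p \<beta>' \<le> real s"
    if X: "X \<in> A" and W: "W \<in> B"
      and opt: "is_LASSO n p X (\<lambda>i. mat_vec p X \<beta> i + W i) lam \<beta>' \<or>
        is_LASSO_box n p X (\<lambda>i. mat_vec p X \<beta> i + W i) lam \<beta>'" for X W \<beta>'
  proof -
    have design: "correlated_blocks (b / 4) n q s X u" for u
    proof (rule correlated_blocks_from_lattice[where N="p\<^sup>2" and R="2 * real p"])
      have "2 * n \<le> p * p" using p \<open>n \<le> p\<close> by (intro mult_mono) auto
      then show "2 * real n \<le> real (p\<^sup>2)"
        by (metis of_nat_le_iff of_nat_mult of_nat_numeral power2_eq_square)
      have "real n * (8 * real p) \<le> real p * (b * real p)"
        using b \<open>n \<le> p\<close> by (intro mult_mono) auto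
      then show "4 * real n * (2 * real p) \<le> b * real (p\<^sup>2)"
        by (simp add: power2_eq_square mult_ac)
      show "\<bar>X (i, j)\<bar> \<le> 2 * real p" if "i < n" "j < s * q" for i j
      proof -
        have "(X (i, j))\<^sup>2 \<le> (\<Sum>ij\<in>{..<n} \<times> {..<p}. (X ij)\<^sup>2)"
          using that q by (intro member_le_sum) auto
        also have "\<dots> \<le> 4 * real (n * p)"
          using X by (auto simp: A_def B1_def)
        also have "\<dots> \<le> 4 * (real p * real p)"
          using \<open>n \<le> p\<close> by (simp add: mult_right_mono)
        finally have "(X (i, j))\<^sup>2 \<le> (2 * real p)\<^sup>2" by (simp add: power2_eq_square)
        then show ?thesis by (metis abs_le_square_iff abs_of_nonneg of_nat_0_le_iff mult_nonneg_nonneg zero_le_numeral)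
      qed
      show "correlated_blocks b n q s X (\<lambda>i. of_int (m i))"
        if "m \<in> {..<n} \<rightarrow>\<^sub>E {- int (p\<^sup>2)..int (p\<^sup>2)}" "norm2 n (\<lambda>i. of_int (m i)) \<noteq> 0" for m
        using X that by (auto simp: A_def B3_def \<Lambda>_def)
    qed (use q p b in auto)
    have Y: "norm2 n (\<lambda>i. mat_vec p X \<beta> i + W i) \<le> real s * (b / 4)"
    proof -
      have "(norm2 n (mat_vec p X \<beta>))\<^sup>2 \<le> 4 * real n * real k"
        using X by (auto simp: A_def B2_def)
      then have 1: "norm2 n (mat_vec p X \<beta>) \<le> sqrt (4 * real n * real k)"
        by (rule real_le_rsqrt)
      have "(norm2 n W)\<^sup>2 \<le> 4 * real n * \<sigma>\<^sup>2"
        using W by (auto simp: B_def BW_def norm2_sq)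
      also have "\<dots> \<le> 4 * real n * real k"
        using \<open>\<sigma>\<^sup>2 \<le> real k\<close> by (intro mult_left_mono) auto
      finally have 2: "norm2 n W \<le> sqrt (4 * real n * real k)"
        by (rule real_le_rsqrt)
      have "norm2 n (\<lambda>i. mat_vec p X \<beta> i + W i) \<le> norm2 n (mat_vec p X \<beta>) + norm2 n W"
        unfolding norm2_def by (rule L2_set_triangle_ineq)
      also have "\<dots> \<le> 2 * sqrt (4 * real n * real k)" using 1 2 by linarith
      also have "\<dots> = sqrt (16 * real k * real n)"
        by (simp add: real_sqrt_mult)
      (* this step fixes the admissible size of c: 16 / 10000 has to be at most 1 / 576 *)
      also have "\<dots> \<le> sqrt (16 * real k * (real k * ln (real p) / 10000))"
        using n_upper by (intro real_sqrt_le_mono mult_left_mono) auto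
      also have "\<dots> \<le> sqrt ((real k / 24 * (2 * b))\<^sup>2)"
      proof (rule real_sqrt_le_mono)
        have "0 \<le> real k * (real k * ln (real p))" using assms(4) by simp
        moreover have "(real k / 24 * (2 * b))\<^sup>2 = real k * (real k * ln (real p)) / 576"
          by (simp add: power_mult_distrib power_divide b(2)) (simp add: power2_eq_square)
        ultimately show "16 * real k * (real k * ln (real p) / 10000) \<le> (real k / 24 * (2 * b))\<^sup>2"
          by linarith
      qed
      also have "\<dots> = real k / 12 * b" using b by simp
      also have "\<dots> \<le> real s * (b / 4)" using mult_right_mono[OF k3, of "b / 12"] b by simp
      finally show ?thesis .
    qed
    show ?thesis
      using opt lasso_norm1_le_blocks[OF _ \<open>0 < lam\<close> q(2) design Y] p by blast
  qed
  ultimately show ?thesis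
    unfolding with_prob_at_least_def model_law_def P_def[symmetric] Q_def[symmetric]
    by (intro bexI[of _ "A \<times> B"]) auto
qed

section \<open>Comparison of the parameters\<close>

text \<open>
  The number of lattice vectors and blocks is at most \<open>p ^ (5 * n)\<close>, and \<open>n\<close> is at most
  \<open>p powr (1/8) * ln p\<close>.  On the other side a block has at least \<open>p powr (7/8)\<close>
  columns, each of which is good with probability at least \<open>\<tau>\<close>, which is \<open>p powr (-1/4)\<close> up to a constant;
  with \<open>1 - \<tau> \<le> exp (- \<tau>)\<close> this leaves \<open>p powr (5/8)\<close>.
\<close>
lemma lattice_failure_small:
  fixes n p k s :: nat
  assumes "2 \<le> p" "0 < s" "2 * s \<le> k" "k \<le> p" "0 < n"
    and k: "real k \<le> real p powr (1/8)" and n: "real n \<le> real k * ln (real p)"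
  shows "real ((2 * p\<^sup>2 + 1) ^ n * s) * (1 - exp (- (ln (real p) / 4) - 1) / 4) ^ (p div s)
    \<le> exp (5 * real p powr (1/8) * (ln (real p))\<^sup>2 - real p powr (5/8) * (exp (-1) / 4))"
proof -
  define x where "x = real p"
  define \<tau> where "\<tau> = exp (- (ln x / 4) - 1) / 4"
  have x: "2 \<le> x" "0 < x" "0 < ln x" using \<open>2 \<le> p\<close> by (auto simp: x_def)
  have \<tau>: "0 \<le> \<tau>" "\<tau> \<le> 1" "\<tau> = x powr (-1/4) * (exp (-1) / 4)"
  proof -
    have "- (ln x / 4) - 1 \<le> 0" using x(3) by linarith
    then have "exp (- (ln x / 4) - 1) \<le> 1" by simp
    then show "\<tau> \<le> 1" unfolding \<tau>_def by linarith
    show "\<tau> = x powr (-1/4) * (exp (-1) / 4)"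
    proof -
      have "exp (- (ln x / 4) - 1) = exp (-1/4 * ln x) * exp (-1)" by (simp flip: exp_add)
      then show ?thesis using x by (simp add: \<tau>_def powr_def)
    qed
  qed (simp add: \<tau>_def)
  have "2 * p\<^sup>2 + 1 \<le> p ^ 4"
  proof -
    have "4 \<le> p\<^sup>2" using \<open>2 \<le> p\<close> power_mono[of 2 p 2] by simp
    then have "2 * p\<^sup>2 + 1 \<le> 4 * p\<^sup>2" by linarith
    also have "\<dots> \<le> p\<^sup>2 * p\<^sup>2" using \<open>4 \<le> p\<^sup>2\<close> by (intro mult_right_mono) auto
    finally show ?thesis by (simp add: power_add[symmetric])
  qed
  then have "(2 * p\<^sup>2 + 1) ^ n * s \<le> (p ^ 4) ^ n * p"
    using assms by (intro mult_mono power_mono) auto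
  also have "\<dots> = p ^ (4 * n + 1)" by (simp add: power_mult)
  also have "\<dots> \<le> p ^ (5 * n)" using assms by (intro power_increasing) auto
  finally have "real ((2 * p\<^sup>2 + 1) ^ n * s) \<le> real (p ^ (5 * n))" by (rule of_nat_mono)
  also have "\<dots> = exp (5 * real n * ln x)"
  proof -
    have "exp (5 * real n * ln x) = exp (real (5 * n) * ln x)" by simp
    also have "\<dots> = exp (ln x) ^ (5 * n)" by (rule exp_of_nat_mult)
    also have "\<dots> = x ^ (5 * n)" using x by simp
    finally show ?thesis by (simp add: x_def)
  qed
  also have "\<dots> \<le> exp (5 * x powr (1/8) * (ln x)\<^sup>2)"
  proof -
    have "real k * ln x \<le> x powr (1/8) * ln x"
      using k x by (intro mult_right_mono) (auto simp: x_def)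
    then have "real n \<le> x powr (1/8) * ln x" using n by (simp add: x_def)
    then have "real n * ln x \<le> x powr (1/8) * ln x * ln x"
      using x by (intro mult_right_mono) auto
    then show ?thesis by (simp add: power2_eq_square)
  qed
  finally have card: "real ((2 * p\<^sup>2 + 1) ^ n * s) \<le> exp (5 * x powr (1/8) * (ln x)\<^sup>2)" .
  have "x powr (7/8) \<le> real (p div s)"
  proof -
    have "real (2 * s) \<le> x powr (1/8)" "real (2 * s) \<le> x"
      using assms(3,4) k by (auto simp: x_def)
    have "x powr (7/8) * x powr (1/8) = x" using x by (simp flip: powr_add)
    moreover have "x powr (7/8) * (2 * real s) \<le> x powr (7/8) * x powr (1/8)"
      using \<open>real (2 * s) \<le> x powr (1/8)\<close> by (intro mult_left_mono) auto
    ultimately have "2 * (x powr (7/8) * real s) \<le> x" by simp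
    moreover have "x \<le> real (p div s) * real s + real s"
    proof -
      have "p \<le> p div s * s + s"
        using mod_less_divisor[OF \<open>0 < s\<close>, of p] div_mult_mod_eq[of p s] by linarith
      then show ?thesis unfolding x_def by (metis of_nat_add of_nat_le_iff of_nat_mult)
    qed
    ultimately have "x powr (7/8) * real s \<le> real (p div s) * real s"
      using \<open>real (2 * s) \<le> x\<close> by simp
    then show ?thesis using \<open>0 < s\<close> by simp
  qed
  have "(1 - \<tau>) ^ (p div s) \<le> exp (- \<tau>) ^ (p div s)"
    using \<tau> exp_ge_add_one_self[of "- \<tau>"] by (intro power_mono) auto
  also have "\<dots> = exp (- (real (p div s) * \<tau>))" by (simp flip: exp_of_nat_mult)
  also have "\<dots> \<le> exp (- (x powr (7/8) * \<tau>))"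
    using \<open>x powr (7/8) \<le> real (p div s)\<close> \<tau>(1) by (simp add: mult_right_mono)
  also have "x powr (7/8) * \<tau> = x powr (5/8) * (exp (-1) / 4)"
    using x unfolding \<tau>(3) by (simp add: mult.assoc[symmetric] flip: powr_add)
  finally have "real ((2 * p\<^sup>2 + 1) ^ n * s) * (1 - \<tau>) ^ (p div s)
      \<le> exp (5 * x powr (1/8) * (ln x)\<^sup>2) * exp (- (x powr (5/8) * (exp (-1) / 4)))"
    using card \<tau>(1,2) by (intro mult_mono) auto
  then show ?thesis by (simp add: \<tau>_def x_def flip: exp_add)
qed

lemma large_dimension_asymptotics:
  fixes C \<epsilon> :: real
  assumes "0 < C" "0 < \<epsilon>"
  shows "\<forall>\<^sub>F x in at_top. 256 \<le> ln x \<and> exp (C * sqrt (ln x)) \<le> x powr (1/8) \<and>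
    x powr (1/8) * ln x \<le> x \<and>
    exp (5 * x powr (1/8) * (ln x)\<^sup>2 - x powr (5/8) * (exp (-1) / 4)) \<le> \<epsilon>"
proof (intro eventually_conj)
  show "\<forall>\<^sub>F x in at_top. 256 \<le> ln (x::real)" by real_asymp
  show "\<forall>\<^sub>F x in at_top. exp (C * sqrt (ln x)) \<le> x powr (1/8)"
    using \<open>0 < C\<close> by real_asymp
  show "\<forall>\<^sub>F x in at_top. x powr (1/8) * ln x \<le> (x::real)" by real_asymp
  have "((\<lambda>x::real. exp (5 * x powr (1/8) * (ln x)\<^sup>2 - x powr (5/8) * (exp (-1) / 4))) \<longlongrightarrow> 0) at_top"
    by real_asymp
  from order_tendstoD(2)[OF this \<open>0 < \<epsilon>\<close>]
  show "\<forall>\<^sub>F x in at_top. exp (5 * x powr (1/8) * (ln x)\<^sup>2 - x powr (5/8) * (exp (-1) / 4)) \<le> \<epsilon>"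
    by (rule eventually_mono) simp
qed

text \<open>
  With \<open>E = exp (L / 5)\<close>, the hypothesis bounds \<open>E ^ 10\<close> by \<open>2 * x + 1\<close>.  If \<open>x < 4 * E\<^sup>2\<close> held,
  this would force \<open>E ^ 8 < 9\<close>.
\<close>
lemma signal_to_noise_dominates:
  fixes x L :: real
  assumes "4608 \<le> L" and "exp (2 * L) \<le> 2 * x + 1"
  shows "4 * (exp (L / 5))\<^sup>2 \<le> x"
proof (rule ccontr)
  assume less: "\<not> ?thesis"
  define E where "E = exp (L / 5)"
  have "1 + L / 5 \<le> E" unfolding E_def by (rule exp_ge_add_one_self)
  then have E: "900 \<le> E" using assms(1) by linarith
  have "E ^ 2 * E ^ 8 = exp (2 * L)" by (simp add: E_def mult_exp_exp flip: exp_of_nat_mult)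
  also have "\<dots> \<le> 2 * x + 1" by fact
  also have "\<dots> < 8 * E ^ 2 + E ^ 2"
    using less one_le_power[of E 2] E unfolding E_def[symmetric] by linarith
  finally have "E ^ 2 * E ^ 8 < E ^ 2 * 9" by linarith
  then have "E ^ 8 < 9" by (rule mult_left_less_imp_less) simp
  moreover have "(900::real) ^ 8 \<le> E ^ 8" using E by (intro power_mono) auto
  ultimately show False by simp
qed

section \<open>The lower bound on the error\<close>

theorem theorem2p1:
  fixes C C' :: real
  assumes "0 < C" and "0 < C'"
  shows "\<exists>c>0. \<forall>\<epsilon>>0. \<exists>k0::nat.
    \<forall>(n::nat) (p::nat) (k::nat) (\<sigma>::real) (\<beta>::nat \<Rightarrow> real) (lam::real).
      0 < n \<and> 0 < p \<and> 0 < k \<and> 0 < \<sigma> \<and> k0 \<le> k \<and> k < n \<and>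
      C' * \<sigma>\<^sup>2 \<le> real k \<and>
      real k \<le> min 1 (\<sigma>\<^sup>2) * exp (C * sqrt (ln (real p))) \<and>
      n_star p k \<sigma> \<le> real n \<and> real n \<le> c * real k * ln (real p) \<and>
      binary_sparse p k \<beta> \<and>
      \<sigma> / sqrt (real k) * exp (- (real k * ln (real p) / (5 * real n))) \<le> lam
      \<longrightarrow> with_prob_at_least (model_law n p \<sigma>) (1 - \<epsilon>)
            (\<lambda>(X, W).
               let Y = (\<lambda>i. mat_vec p X \<beta> i + W i) in
               \<forall>b b_box. is_LASSO n p X Y lam b \<and> is_LASSO_box n p X Y lam b_box \<longrightarrow>
                 exp (real k * ln (real p) / (5 * real n)) * \<sigma>
                   \<le> min (norm2 p (\<lambda>j. b j - \<beta> j)) (norm2 p (\<lambda>j. b_box j - \<beta> j)))"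
proof (rule exI[of _ "1 / 10000"], intro conjI allI impI)
  fix \<epsilon> :: real assume "0 < \<epsilon>"
  let ?\<rho> = "sqrt 2 * exp (-1) :: real"
  have \<rho>: "0 \<le> ?\<rho>" "?\<rho> < 1"
  proof -
    have "1 + 1 \<le> exp (1::real)" by (rule exp_ge_add_one_self)
    moreover have "sqrt 2 < sqrt 4" by (intro real_sqrt_less_mono) auto
    ultimately show "?\<rho> < 1" by (simp add: exp_minus field_simps)
  qed simp
  obtain x0 where x0: "\<And>x. x0 \<le> x \<Longrightarrow> 256 \<le> ln x \<and> exp (C * sqrt (ln x)) \<le> x powr (1/8) \<and>
      x powr (1/8) * ln x \<le> x \<and>
      exp (5 * x powr (1/8) * (ln x)\<^sup>2 - x powr (5/8) * (exp (-1) / 4)) \<le> \<epsilon> / 4"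
    using large_dimension_asymptotics[OF \<open>0 < C\<close>, of "\<epsilon> / 4"] \<open>0 < \<epsilon>\<close>
    unfolding eventually_at_top_linorder by auto
  obtain k1 where k1: "?\<rho> ^ k1 < \<epsilon> / 4"
    using real_arch_pow_inv[of "\<epsilon> / 4" ?\<rho>] \<rho> \<open>0 < \<epsilon>\<close> by auto
  (* k <= exp (C * sqrt (ln p)), so a k beyond k2 forces p beyond x0 *)
  obtain k2 :: nat where k2: "exp (C * sqrt (ln (max 1 x0))) < real k2"
    using reals_Archimedean2 by blast
  show "\<exists>k0::nat. \<forall>(n::nat) (p::nat) (k::nat) (\<sigma>::real) (\<beta>::nat \<Rightarrow> real) (lam::real).
      0 < n \<and> 0 < p \<and> 0 < k \<and> 0 < \<sigma> \<and> k0 \<le> k \<and> k < n \<and>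
      C' * \<sigma>\<^sup>2 \<le> real k \<and>
      real k \<le> min 1 (\<sigma>\<^sup>2) * exp (C * sqrt (ln (real p))) \<and>
      n_star p k \<sigma> \<le> real n \<and> real n \<le> 1 / 10000 * real k * ln (real p) \<and>
      binary_sparse p k \<beta> \<and>
      \<sigma> / sqrt (real k) * exp (- (real k * ln (real p) / (5 * real n))) \<le> lam
      \<longrightarrow> with_prob_at_least (model_law n p \<sigma>) (1 - \<epsilon>)
            (\<lambda>(X, W).
               let Y = (\<lambda>i. mat_vec p X \<beta> i + W i) in
               \<forall>b b_box. is_LASSO n p X Y lam b \<and> is_LASSO_box n p X Y lam b_box \<longrightarrow>
                 exp (real k * ln (real p) / (5 * real n)) * \<sigma>
                   \<le> min (norm2 p (\<lambda>j. b j - \<beta> j)) (norm2 p (\<lambda>j. b_box j - \<beta> j)))"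
  proof (rule exI[of _ "max 2 (max k1 k2)"], intro allI impI, elim conjE)
    fix n p k :: nat and \<sigma> lam :: real and \<beta> :: "nat \<Rightarrow> real"
    assume pos: "0 < n" "0 < p" "0 < k" "0 < \<sigma>" and k0: "max 2 (max k1 k2) \<le> k" and "k < n"
      and k_upper: "real k \<le> min 1 (\<sigma>\<^sup>2) * exp (C * sqrt (ln (real p)))"
      and n_lower: "n_star p k \<sigma> \<le> real n" and n_upper: "real n \<le> 1 / 10000 * real k * ln (real p)"
      and bin: "binary_sparse p k \<beta>"
      and lam: "\<sigma> / sqrt (real k) * exp (- (real k * ln (real p) / (5 * real n))) \<le> lam"
    have k: "2 \<le> k" "k1 \<le> k" "k2 \<le> k" using k0 by auto
    have "0 < \<sigma> / sqrt (real k) * exp (- (real k * ln (real p) / (5 * real n)))"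
      using pos by simp
    then have "0 < lam" using lam by linarith
    have k_exp: "real k \<le> exp (C * sqrt (ln (real p)))"
    proof -
      have "min 1 (\<sigma>\<^sup>2) * exp (C * sqrt (ln (real p))) \<le> 1 * exp (C * sqrt (ln (real p)))"
        by (intro mult_right_mono) auto
      then show ?thesis using k_upper by linarith
    qed
    have "x0 \<le> real p"
    proof (rule ccontr)
      assume "\<not> ?thesis"
      then have "real p \<le> max 1 x0" by simp
      then have "exp (C * sqrt (ln (real p))) \<le> exp (C * sqrt (ln (max 1 x0)))"
        using pos \<open>0 < C\<close> by simp
      then show False using k2 k_exp k(3) by linarith
    qed
    note large = x0[OF this]
    have k_small: "real k \<le> real p powr (1/8)" using k_exp large by linarith
    have kp: "k \<le> p"
    proof -
      have "{j. j < p \<and> \<beta> j \<noteq> 0} \<subseteq> {..<p}" by auto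
      from card_mono[OF _ this] show ?thesis using bin by (simp add: binary_sparse_def)
    qed
    have n_k: "real n \<le> real k * ln (real p)"
    proof -
      have "0 \<le> real k * ln (real p)" using large by simp
      then show ?thesis using n_upper by simp
    qed
    have "real k * ln (real p) \<le> real p powr (1/8) * ln (real p)"
      using k_small large by (intro mult_right_mono) auto
    then have "n \<le> p" using n_k large by linarith
    define L where "L = real k * ln (real p) / real n"
    have L: "10000 \<le> L" using n_upper pos by (simp add: L_def field_simps)
    define x where "x = real k / \<sigma>\<^sup>2"
    have "0 < x" using pos by (simp add: x_def)
    have "2 * L \<le> ln (2 * x + 1)"
    proof -
      have "0 < ln (2 * x + 1)" using \<open>0 < x\<close> by simp
      moreover have "2 * real k * ln (real p) / ln (2 * x + 1) \<le> real n"
        using n_lower by (simp add: n_star_def x_def)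
      ultimately have "2 * real k * ln (real p) \<le> real n * ln (2 * x + 1)"
        by (simp add: divide_le_eq)
      then show ?thesis using pos by (simp add: L_def divide_le_eq mult_ac)
    qed
    then have "exp (2 * L) \<le> 2 * x + 1"
      using \<open>0 < x\<close> by (simp add: ln_ge_iff)
    then have snr: "4 * (exp (L / 5))\<^sup>2 \<le> x"
      using L by (intro signal_to_noise_dominates) auto
    have "1 \<le> (exp (L / 5))\<^sup>2" using L by (intro one_le_power) simp
    then have "1 \<le> x" using snr by linarith
    then have \<sigma>k: "\<sigma>\<^sup>2 \<le> real k" using pos by (simp add: x_def)
    have "(2 * exp (L / 5) * \<sigma>)\<^sup>2 \<le> real k"
      using snr pos by (simp add: x_def power_mult_distrib field_simps)
    then have far: "2 * (exp (L / 5) * \<sigma>) \<le> sqrt (real k)"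
      using real_le_rsqrt by (simp add: mult.assoc)
    let ?s = "k div 2"
    have dist: "exp (L / 5) * \<sigma> \<le> norm2 p (\<lambda>j. b j - \<beta> j)" if "norm1 p b \<le> real ?s" for b
    proof -
      have "real k / 2 \<le> real k - real ?s" by linarith
      also have "\<dots> \<le> sqrt (real k) * norm2 p (\<lambda>j. b j - \<beta> j)"
        by (rule distance_from_binary_ge[OF bin that])
      finally have "sqrt (real k) * (sqrt (real k) / 2) \<le> sqrt (real k) * norm2 p (\<lambda>j. b j - \<beta> j)"
        by simp
      then have "sqrt (real k) / 2 \<le> norm2 p (\<lambda>j. b j - \<beta> j)"
        by (rule mult_left_le_imp_le) (use pos in simp)
      then show ?thesis using far by linarith
    qed
    define \<eta> where "\<eta> = 3 * ?\<rho> ^ n +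
      real ((2 * p\<^sup>2 + 1) ^ n * ?s) * (1 - exp (- (ln (real p) / 4) - 1) / 4) ^ (p div ?s)"
    have "?\<rho> ^ n \<le> ?\<rho> ^ k1" using \<rho> k(2) \<open>k < n\<close> by (intro power_decreasing) auto
    moreover have "real ((2 * p\<^sup>2 + 1) ^ n * ?s) * (1 - exp (- (ln (real p) / 4) - 1) / 4) ^ (p div ?s) \<le> \<epsilon> / 4"
      using lattice_failure_small[of p ?s k n] k(1) kp pos k_small n_k large by auto
    ultimately have "\<eta> \<le> \<epsilon>" using k1 unfolding \<eta>_def by linarith
    moreover have "with_prob_at_least (model_law n p \<sigma>) (1 - \<eta>)
        (\<lambda>(X, W). \<forall>b. is_LASSO n p X (\<lambda>i. mat_vec p X \<beta> i + W i) lam b \<or>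
            is_LASSO_box n p X (\<lambda>i. mat_vec p X \<beta> i + W i) lam b \<longrightarrow> norm1 p b \<le> real ?s)"
      unfolding \<eta>_def using k(1) \<open>k < n\<close> \<open>n \<le> p\<close> large pos \<sigma>k \<open>0 < lam\<close> bin n_upper
      by (intro lasso_norm1_small_prob) auto
    ultimately obtain A where A: "A \<in> sets (model_law n p \<sigma>)" "1 - \<epsilon> \<le> measure (model_law n p \<sigma>) A"
      and good: "\<And>X W b. (X, W) \<in> A \<Longrightarrow> is_LASSO n p X (\<lambda>i. mat_vec p X \<beta> i + W i) lam b \<or>
            is_LASSO_box n p X (\<lambda>i. mat_vec p X \<beta> i + W i) lam b \<Longrightarrow> norm1 p b \<le> real ?s"
      unfolding with_prob_at_least_def by fastforce
    have L5: "real k * ln (real p) / (5 * real n) = L / 5" by (simp add: L_def)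
    show "with_prob_at_least (model_law n p \<sigma>) (1 - \<epsilon>)
            (\<lambda>(X, W).
               let Y = (\<lambda>i. mat_vec p X \<beta> i + W i) in
               \<forall>b b_box. is_LASSO n p X Y lam b \<and> is_LASSO_box n p X Y lam b_box \<longrightarrow>
                 exp (real k * ln (real p) / (5 * real n)) * \<sigma>
                   \<le> min (norm2 p (\<lambda>j. b j - \<beta> j)) (norm2 p (\<lambda>j. b_box j - \<beta> j)))"
      unfolding with_prob_at_least_def L5 Let_def
      using A by (intro bexI[of _ A]) (auto intro!: dist good)
  qed
qed simp

end
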